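(* $$\pi^3\, m\big((1+w)(1+x)+(1-w)(y+z)\big)=2\pi^2\,L(\chi_{-4},2)+8\sum_{0\le j<k}\frac{(-1)^{j+k+1}}{(2j+1)^3k},$$ where the polynomial is in the four variables $w,x,y,z$ and the sum is over pairs of integers $(j,k)$ with $0\le j<k$.
   Context: The (logarithmic) Mahler measure of a nonzero polynomial $P\in\mathbb{C}[x_1,\dots,x_n]$ is $m(P)=\frac{1}{(2\pi i)^n}\int_{\mathbb{T}^n}\log|P(x_1,\dots,x_n)|\,\frac{dx_1}{x_1}\cdots\frac{dx_n}{x_n}$, with $\mathbb{T}^n=\{|x_1|=\dots=|x_n|=1\}$. $\chi_{-4}(n)=1$ if $n\equiv1\bmod4$, $-1$ if $n\equiv-1\bmod4$, $0$ otherwise, and $L(\chi_{-4},s)=\sum_{n\ge1}\chi_{-4}(n)n^{-s}$. The double sum, which is only conditionally convergent, is understood as $\lim_{N\to\infty}\sum_{0\le j<k\le N}$. *)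

theory Defs
  imports "HOL-Analysis.Analysis" "HOL-Library.Poly_Mapping"
begin

text \<open>
  Polynomials over the complex numbers in variables indexed by \<^typ>\<open>nat\<close>: finitely supported
  coefficient functions on exponent vectors. Sum and product are the (convolution) ring
  operations of \<^type>\<open>poly_mapping\<close>.
\<close>

type_synonym cpoly = "(nat \<Rightarrow>\<^sub>0 nat) \<Rightarrow>\<^sub>0 complex"

definition pvar :: "nat \<Rightarrow> cpoly" where
  "pvar i = Poly_Mapping.single (Poly_Mapping.single i 1) 1"

definition monom_eval :: "(nat \<Rightarrow> complex) \<Rightarrow> (nat \<Rightarrow>\<^sub>0 nat) \<Rightarrow> complex" where
  "monom_eval a e = (\<Prod>i\<in>Poly_Mapping.keys e. a i ^ Poly_Mapping.lookup e i)"

definition peval :: "cpoly \<Rightarrow> (nat \<Rightarrow> complex) \<Rightarrow> complex" where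
  "peval P a = (\<Sum>e\<in>Poly_Mapping.keys P. Poly_Mapping.lookup P e * monom_eval a e)"

text \<open>
  The Mahler measure of a nonzero polynomial in the \<open>n\<close> variables with indices in \<open>{..<n}\<close>.
  The torus is parametrised by \<open>x\<^sub>k = cis (t k)\<close> with \<open>t k\<close> in \<open>[0, 2\<pi>]\<close>, so that
  \<open>dx\<^sub>k / x\<^sub>k = \<i> dt\<^sub>k\<close>, and the factor \<open>\<i>^n\<close> cancels against \<open>(2\<pi>\<i>)^n\<close>.
  On the null set of zeros of \<open>P\<close> the integrand takes the conventional value \<open>ln 0 = 0\<close>.
\<close>

definition mahler_measure :: "nat \<Rightarrow> cpoly \<Rightarrow> real" where
  "mahler_measure n P =
     1 / (2 * pi) ^ n *
     (LINT t : (\<Pi>\<^sub>E k\<in>{..<n}. {0..2 * pi}) | (\<Pi>\<^sub>M k\<in>{..<n}. lborel).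
        ln (cmod (peval P (\<lambda>k. cis (t k)))))"

definition chi_m4 :: "int \<Rightarrow> int" where
  "chi_m4 n = (if n mod 4 = 1 then 1 else if n mod 4 = 3 then -1 else 0)"

definition L_series :: "(int \<Rightarrow> int) \<Rightarrow> real \<Rightarrow> real" where
  "L_series c s = suminf (\<lambda>n. of_int (c (int (Suc n))) * real (Suc n) powr (- s))"

lemma monom_eval_superset:
  assumes "finite S" "Poly_Mapping.keys e \<subseteq> S"
  shows "monom_eval a e = (\<Prod>i\<in>S. a i ^ Poly_Mapping.lookup e i)"
  unfolding monom_eval_def
  by (rule prod.mono_neutral_left) (use assms in \<open>auto simp: in_keys_iff\<close>)

lemma monom_eval_0 [simp]: "monom_eval a 0 = 1"
  by (simp add: monom_eval_def)

lemma monom_eval_add: "monom_eval a (e + f) = monom_eval a e * monom_eval a f"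
proof -
  let ?S = "Poly_Mapping.keys e \<union> Poly_Mapping.keys f"
  have "Poly_Mapping.keys (e + f) \<subseteq> ?S"
    by (rule keys_add)
  then show ?thesis
    by (simp add: monom_eval_superset[of ?S] lookup_add power_add prod.distrib)
qed

lemma peval_superset:
  assumes "finite S" "Poly_Mapping.keys P \<subseteq> S"
  shows "peval P a = (\<Sum>e\<in>S. Poly_Mapping.lookup P e * monom_eval a e)"
  unfolding peval_def
  by (rule sum.mono_neutral_left) (use assms in \<open>auto simp: in_keys_iff\<close>)

lemma peval_0 [simp]: "peval 0 a = 0"
  by (simp add: peval_def)

lemma peval_1 [simp]: "peval 1 a = 1"
  by (simp add: peval_def lookup_one)

lemma peval_add: "peval (P + Q) a = peval P a + peval Q a"
proof -
  let ?S = "Poly_Mapping.keys P \<union> Poly_Mapping.keys Q"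
  have "Poly_Mapping.keys (P + Q) \<subseteq> ?S"
    by (rule keys_add)
  then show ?thesis
    by (simp add: peval_superset[of ?S] lookup_add distrib_right sum.distrib)
qed

lemma peval_uminus: "peval (- P) a = - peval P a"
  using peval_add[of P "- P" a] by (simp add: eq_neg_iff_add_eq_0 add.commute)

lemma peval_diff: "peval (P - Q) a = peval P a - peval Q a"
  using peval_add[of P "- Q" a] by (simp add: peval_uminus)

lemma peval_single: "peval (Poly_Mapping.single e c) a = c * monom_eval a e"
  by (cases "c = 0") (simp_all add: peval_def)

lemma peval_pvar [simp]: "peval (pvar i) a = a i"
  by (simp add: pvar_def peval_single monom_eval_def)

lemma cpoly_as_sum:
  "P = (\<Sum>e\<in>Poly_Mapping.keys P. Poly_Mapping.single e (Poly_Mapping.lookup P e))"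
  for P :: cpoly
  by (rule poly_mapping_eqI)
    (simp add: lookup_sum lookup_single when_def in_keys_iff)

lemma peval_sum: "peval (\<Sum>i\<in>I. F i) a = (\<Sum>i\<in>I. peval (F i) a)"
  by (induction I rule: infinite_finite_induct) (simp_all add: peval_add)

lemma peval_mult: "peval (P * Q) a = peval P a * peval Q a"
proof -
  have "P * Q = (\<Sum>e\<in>Poly_Mapping.keys P. \<Sum>f\<in>Poly_Mapping.keys Q.
      Poly_Mapping.single (e + f) (Poly_Mapping.lookup P e * Poly_Mapping.lookup Q f))"
    by (subst cpoly_as_sum[of P], subst cpoly_as_sum[of Q])
      (simp add: sum_product mult_single)
  then have "peval (P * Q) a = (\<Sum>e\<in>Poly_Mapping.keys P. \<Sum>f\<in>Poly_Mapping.keys Q.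
      Poly_Mapping.lookup P e * Poly_Mapping.lookup Q f * (monom_eval a e * monom_eval a f))"
    by (simp add: peval_sum peval_single monom_eval_add)
  then show ?thesis
    by (simp add: peval_def sum_product mult_ac)
qed

end

theory Submission
  imports Defs "HOL-Complex_Analysis.Cauchy_Integral_Formula" "HOL-Real_Asymp.Real_Asymp"
begin

text \<open>
  Write \<open>m\<close> for the Mahler measure and \<open>P = (1 + w) (1 + x) + (1 - w) (y + z)\<close>. The measure-preserving
  substitution \<open>z \<mapsto> y z\<close> makes \<open>P\<close> linear in \<open>y\<close>, with coefficients \<open>(1 + w) (1 + x)\<close> and
  \<open>(1 - w) (1 + z)\<close>. Jensen's formula removes \<open>y\<close>, and \<open>m(P)\<close> is the mean of
  \<open>ln (max \<bar>(1 + w) (1 + x)\<bar> \<bar>(1 - w) (1 + z)\<bar>)\<close> (\<open>nn_integral_ln_norm_bilinear\<close>,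
  \<open>nn_integral_torus_value\<close>). In half angles, \<open>\<bar>1 + w\<bar> = 2 \<bar>cos a\<bar>\<close> and \<open>\<bar>1 - w\<bar> = 2 \<bar>sin a\<bar>\<close>. The
  functions \<open>ln \<bar>1 \<plusminus> w\<bar>\<close> have mean zero (\<open>nn_integral_ln_sin\<close>), so \<open>m(P)\<close> is \<open>(2/\<pi>)\<^sup>3\<close> times the integral
  over \<open>0 < a < \<pi>/2\<close> of \<open>H (cot a)\<close>, where \<open>H r\<close> is the double integral of
  \<open>max 0 (ln (r cos b / cos d))\<close> over \<open>0 < b, d < \<pi>/2\<close>, called \<open>cos_ratio_integral\<close> below.

  For \<open>0 < r < 1\<close>, a layer cake decomposition of the logarithm expresses \<open>H\<close> through the mean of
  \<open>arcsin (s cos b)\<close>, and \<open>H r\<close> is the sum of \<open>r\<^sup>2\<^sup>n\<^sup>+\<^sup>1 / (2 n + 1)\<^sup>3\<close> (\<open>cos_ratio_integral_series\<close>).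
  Moreover \<open>H (1/r) = - (\<pi>/2)\<^sup>2 ln r + H r\<close> (\<open>cos_ratio_integral_inverse\<close>). Folding the integral over
  \<open>a\<close> at \<open>\<pi>/4\<close>, it becomes the integral of \<open>- (\<pi>/2)\<^sup>2 ln (tan a) + 2 H (tan a)\<close> over
  \<open>0 < a < \<pi>/4\<close>. The first term contributes Catalan's constant (\<open>nn_integral_ln_tan\<close>). In the second, the
  integrals \<open>A n\<close> of \<open>tan\<^sup>2\<^sup>n\<^sup>+\<^sup>1\<close> satisfy \<open>2 A n + 2 A (n + 1) = 1 / (n + 1)\<close>, so \<open>2 A n\<close> is the
  alternating tail of the harmonic series beginning with \<open>1 / (n + 1)\<close>, and summation against
  \<open>1 / (2 n + 1)\<^sup>3\<close> gives the double sum (\<open>double_sum_limit\<close>).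

  All integrals are integrals of nonnegative functions with values in \<open>ennreal\<close>, so that Tonelli's theorem
  applies without integrability conditions. Identities between signed quantities are
  rearranged into sums of nonnegative ones, and integrability of \<open>ln \<bar>P\<bar>\<close> on the torus is read off
  from the finite result.
\<close>

section \<open>Integration over intervals\<close>

text \<open>
  Intervals enter as measures on the whole line, so that iterated integrals need no indicator
  functions and every integrand only has to be Borel measurable. The interval is open because
  most integrands below are singular at an endpoint.
\<close>

definition lborel_on :: "real \<Rightarrow> real \<Rightarrow> real measure" where
  "lborel_on a b = density lborel (indicator {a<..<b})"

lemma sets_lborel_on [simp, measurable_cong]: "sets (lborel_on a b) = sets borel"
  by (simp add: lborel_on_def)

lemma space_lborel_on [simp]: "space (lborel_on a b) = UNIV"
  by (simp add: lborel_on_def)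

lemma emeasure_lborel_on: "A \<in> sets borel \<Longrightarrow> emeasure (lborel_on a b) A = emeasure lborel ({a<..<b} \<inter> A)"
  unfolding lborel_on_def by (subst emeasure_density) (auto simp: indicator_inter_arith[symmetric])

interpretation lborel_on: finite_measure "lborel_on a b" for a b
  by standard (cases "a \<le> b"; simp add: emeasure_lborel_on)

lemma AE_lborel_on: "AE x in lborel_on a b. a < x \<and> x < b"
  unfolding lborel_on_def by (subst AE_density) (auto split: split_indicator)

lemma AE_lborel_on_neq: "AE x in lborel_on a b. x \<noteq> c"
  unfolding lborel_on_def by (subst AE_density) (use AE_lborel_singleton[of c] in auto)

lemma nn_integral_lborel_on:
  "f \<in> borel_measurable borel \<Longrightarrow>
    (\<integral>\<^sup>+x. f x \<partial>lborel_on a b) = (\<integral>\<^sup>+x. indicator {a<..<b} x * f x \<partial>lborel)"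
  unfolding lborel_on_def by (subst nn_integral_density) auto

lemma nn_integral_lborel_on_cong:
  assumes "\<And>x. a < x \<Longrightarrow> x < b \<Longrightarrow> f x = g x"
  shows "(\<integral>\<^sup>+x. f x \<partial>lborel_on a b) = (\<integral>\<^sup>+x. g x \<partial>lborel_on a b)"
  by (rule nn_integral_cong_AE, rule AE_mp[OF AE_lborel_on]) (use assms in auto)

lemma nn_integral_lborel_on_mono:
  assumes "\<And>x. a < x \<Longrightarrow> x < b \<Longrightarrow> f x \<le> g x"
  shows "(\<integral>\<^sup>+x. f x \<partial>lborel_on a b) \<le> (\<integral>\<^sup>+x. g x \<partial>lborel_on a b)"
  by (rule nn_integral_mono_AE, rule AE_mp[OF AE_lborel_on]) (use assms in auto)

lemma emeasure_lborel_on_UNIV [simp]: "a \<le> b \<Longrightarrow> emeasure (lborel_on a b) UNIV = ennreal (b - a)"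
  by (simp add: emeasure_lborel_on)

lemma borel_measurable_cis [measurable (raw)]:
  "f \<in> borel_measurable M \<Longrightarrow> (\<lambda>x. cis (f x)) \<in> borel_measurable M"
  by (rule measurable_compose[where N = borel], assumption)
     (intro borel_measurable_continuous_onI continuous_intros)

lemma nn_integral_lborel_on_has_integral:
  fixes f :: "real \<Rightarrow> real"
  assumes [measurable]: "f \<in> borel_measurable borel" and I: "(f has_integral I) {a..b}"
    and nonneg: "\<And>x. a < x \<Longrightarrow> x < b \<Longrightarrow> 0 \<le> f x"
  shows "(\<integral>\<^sup>+x. f x \<partial>lborel_on a b) = ennreal I"
proof -
  let ?g = "\<lambda>x. indicator {a<..<b} x * f x"
  have "(f has_integral I) {a<..<b}"
    using I has_integral_open_interval[of f I a b] by (simp add: box_real)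
  then have "((\<lambda>x. if x \<in> {a<..<b} then f x else 0) has_integral I) UNIV"
    by (subst has_integral_restrict_UNIV)
  also have "(\<lambda>x. if x \<in> {a<..<b} then f x else 0) = ?g"
    by (auto simp: indicator_def)
  finally have "integral\<^sup>N lborel ?g = ennreal I"
    by (intro nn_integral_has_integral_lborel) (auto simp: nonneg indicator_def)
  moreover have "(\<integral>\<^sup>+x. f x \<partial>lborel_on a b) = integral\<^sup>N lborel ?g"
    by (subst nn_integral_lborel_on) (auto intro!: nn_integral_cong simp: indicator_def)
  ultimately show ?thesis by simp
qed

text \<open>
  Only the antiderivative has to extend continuously to the endpoints; the integrand may be
  unbounded there, as for \<open>ln\<close> at \<open>0\<close>.
\<close>

lemma nn_integral_lborel_on_FTC:
  fixes f F :: "real \<Rightarrow> real"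
  assumes f: "f \<in> borel_measurable borel" and "a \<le> b"
    and cont: "continuous_on {a..b} F"
    and der: "\<And>x. a < x \<Longrightarrow> x < b \<Longrightarrow> (F has_real_derivative f x) (at x)"
    and nonneg: "\<And>x. a < x \<Longrightarrow> x < b \<Longrightarrow> 0 \<le> f x"
  shows "(\<integral>\<^sup>+x. f x \<partial>lborel_on a b) = ennreal (F b - F a)"
proof (rule nn_integral_lborel_on_has_integral[OF f _ nonneg])
  show "(f has_integral (F b - F a)) {a..b}"
    using fundamental_theorem_of_calculus_interior[OF \<open>a \<le> b\<close> cont] der
    by (simp add: has_real_derivative_iff_has_vector_derivative)
qed

lemma nn_integral_lborel_on_swap:
  assumes "case_prod f \<in> borel_measurable (borel \<Otimes>\<^sub>M borel)"
  shows "(\<integral>\<^sup>+x. \<integral>\<^sup>+y. f x y \<partial>lborel_on c d \<partial>lborel_on a b) =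
         (\<integral>\<^sup>+y. \<integral>\<^sup>+x. f x y \<partial>lborel_on a b \<partial>lborel_on c d)"
proof -
  interpret pair_sigma_finite "lborel_on c d" "lborel_on a b" ..
  have [measurable]: "case_prod f \<in> borel_measurable (borel \<Otimes>\<^sub>M borel)"
    by fact
  show ?thesis
    by (rule Fubini'[of "\<lambda>y x. f x y"]) measurable
qed

lemma nn_integral_lborel_on_affine:
  assumes [measurable]: "f \<in> borel_measurable borel" and "c > 0"
  shows "(\<integral>\<^sup>+x. f x \<partial>lborel_on (t + c * a) (t + c * b)) = c * (\<integral>\<^sup>+x. f (t + c * x) \<partial>lborel_on a b)"
proof -
  have "indicator {t + c * a<..<t + c * b} (t + c * x) = (indicator {a<..<b} x :: ennreal)" for x
    using \<open>c > 0\<close> by (auto simp: indicator_def)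
  then show ?thesis using \<open>c > 0\<close>
    by (subst nn_integral_lborel_on, simp, subst nn_integral_real_affine[of _ c t])
       (simp_all add: nn_integral_lborel_on)
qed

lemma nn_integral_lborel_on_reflect:
  assumes [measurable]: "f \<in> borel_measurable borel"
  shows "(\<integral>\<^sup>+x. f x \<partial>lborel_on (t - b) (t - a)) = (\<integral>\<^sup>+x. f (t - x) \<partial>lborel_on a b)"
proof -
  have "indicator {t - b<..<t - a} (t - x) = (indicator {a<..<b} x :: ennreal)" for x
    by (auto simp: indicator_def)
  then show ?thesis
    by (subst nn_integral_lborel_on, simp, subst nn_integral_real_affine[of _ "-1" t])
       (simp_all add: nn_integral_lborel_on)
qed

lemma nn_integral_lborel_on_split:
  assumes [measurable]: "f \<in> borel_measurable borel" and "a \<le> b" "b \<le> c"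
  shows "(\<integral>\<^sup>+x. f x \<partial>lborel_on a c) = (\<integral>\<^sup>+x. f x \<partial>lborel_on a b) + (\<integral>\<^sup>+x. f x \<partial>lborel_on b c)"
proof -
  have "(\<integral>\<^sup>+x. f x \<partial>lborel_on a c) =
      (\<integral>\<^sup>+x. indicator {a<..<b} x * f x + indicator {b<..<c} x * f x \<partial>lborel)"
    unfolding nn_integral_lborel_on[OF assms(1)]
    by (rule nn_integral_cong_AE, rule AE_mp[OF AE_lborel_singleton[of b]])
       (use assms in \<open>auto simp: indicator_def\<close>)
  then show ?thesis
    by (simp add: nn_integral_add nn_integral_lborel_on)
qed

lemma nn_integral_lborel_on_symmetric:
  assumes [measurable]: "f \<in> borel_measurable borel" and "0 \<le> c" and "\<And>x. f (2 * c - x) = f x"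
  shows "(\<integral>\<^sup>+x. f x \<partial>lborel_on 0 (2 * c)) = 2 * (\<integral>\<^sup>+x. f x \<partial>lborel_on 0 c)"
proof -
  have "(\<integral>\<^sup>+x. f x \<partial>lborel_on c (2 * c)) = (\<integral>\<^sup>+x. f (2 * c - x) \<partial>lborel_on 0 c)"
    using nn_integral_lborel_on_reflect[of f "2 * c" c 0] by simp
  also have "\<dots> = (\<integral>\<^sup>+x. f x \<partial>lborel_on 0 c)"
    by (simp only: assms(3))
  finally show ?thesis
    unfolding mult_2[of "integral\<^sup>N _ _"]
    using \<open>0 \<le> c\<close> by (subst nn_integral_lborel_on_split[of f 0 c]) simp_all
qed

lemma nn_integral_lborel_on_shift_periodic:
  assumes [measurable]: "f \<in> borel_measurable borel" and per: "\<And>x. f (x + p) = f x" and "0 \<le> s" "s \<le> p"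
  shows "(\<integral>\<^sup>+x. f (s + x) \<partial>lborel_on 0 p) = (\<integral>\<^sup>+x. f x \<partial>lborel_on 0 p)"
proof -
  have "(\<integral>\<^sup>+x. f (s + x) \<partial>lborel_on 0 p) = (\<integral>\<^sup>+x. f x \<partial>lborel_on s (s + p))"
    using nn_integral_lborel_on_affine[of f 1 s 0 p] by simp
  also have "\<dots> = (\<integral>\<^sup>+x. f x \<partial>lborel_on s p) + (\<integral>\<^sup>+x. f x \<partial>lborel_on p (s + p))"
    using assms by (intro nn_integral_lborel_on_split) auto
  also have "(\<integral>\<^sup>+x. f x \<partial>lborel_on p (s + p)) = (\<integral>\<^sup>+x. f x \<partial>lborel_on 0 s)"
    using nn_integral_lborel_on_affine[of f 1 p 0 s] by (simp add: per add.commute)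
  also have "(\<integral>\<^sup>+x. f x \<partial>lborel_on s p) + (\<integral>\<^sup>+x. f x \<partial>lborel_on 0 s) = (\<integral>\<^sup>+x. f x \<partial>lborel_on 0 p)"
    using assms by (subst nn_integral_lborel_on_split[of f 0 s p]) (auto simp: add.commute)
  finally show ?thesis .
qed

section \<open>The log-sine integral\<close>

lemma continuous_on_mult_ln: "continuous_on {0..b} (\<lambda>x::real. x * ln x)"
proof (cases "b > 0")
  case True
  have "((\<lambda>x::real. x * ln x) \<longlongrightarrow> 0) (at_right 0)"
    by real_asymp
  then have "continuous (at 0 within {0..b}) (\<lambda>x::real. x * ln x)"
    using True by (simp add: continuous_within at_within_Icc_at_right)
  moreover have "continuous (at x within {0..b}) (\<lambda>x::real. x * ln x)" if "x > 0" for x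
    using that by (intro continuous_intros) auto
  ultimately show ?thesis
    unfolding continuous_on_eq_continuous_within by (metis atLeastAtMost_iff less_eq_real_def)
next
  case False
  then have "{0..b} \<subseteq> {0}" by auto
  then show ?thesis
    by (rule continuous_on_subset[rotated]) simp
qed

text \<open>
  A weak form of Jordan's inequality, enough to dominate \<open>- ln (sin x)\<close> by an integrable function:
  \<open>sin x = 2 sin (x/2) cos (x/2) \<ge> x cos\<^sup>2 (x/2)\<close> and \<open>cos\<^sup>2 (x/2) \<ge> 1/2\<close>.
\<close>

lemma half_le_sin:
  fixes x :: real
  assumes "0 \<le> x" "x \<le> pi / 2"
  shows "x / 2 \<le> sin x"
proof -
  have "x / 2 * cos (x / 2) \<le> sin (x / 2)"
  proof -
    have "sin 0 - 0 * cos 0 \<le> sin (x / 2) - x / 2 * cos (x / 2)"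
    proof (rule DERIV_nonneg_imp_nondecreasing[where f = "\<lambda>t. sin t - t * cos t"])
      show "\<exists>y. ((\<lambda>t. sin t - t * cos t) has_real_derivative y) (at t) \<and> 0 \<le> y"
        if "0 \<le> t" "t \<le> x / 2" for t
        using that assms
        by (intro exI[of _ "t * sin t"] conjI) (auto intro!: derivative_eq_intros mult_nonneg_nonneg sin_ge_zero)
    qed (use assms in auto)
    then show ?thesis by simp
  qed
  then have "x / 2 * cos (x / 2) * (2 * cos (x / 2)) \<le> sin (x / 2) * (2 * cos (x / 2))"
    using assms by (intro mult_right_mono) (auto intro!: cos_ge_zero)
  also have "sin (x / 2) * (2 * cos (x / 2)) = sin x"
    using sin_double[of "x / 2"] by simp
  also have "x / 2 * cos (x / 2) * (2 * cos (x / 2)) = x / 2 * (1 + cos x)"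
    using cos_double_cos[of "x / 2"] by (simp add: power2_eq_square algebra_simps)
  finally show ?thesis
    using assms mult_nonneg_nonneg[OF assms(1) cos_ge_zero[of x]] by (simp add: algebra_simps)
qed

lemma nn_integral_ln_sin_finite: "(\<integral>\<^sup>+x. ennreal (- ln (sin x)) \<partial>lborel_on 0 (pi / 2)) < \<infinity>"
proof -
  let ?F = "\<lambda>x::real. x * (1 + ln 2) - x * ln x"
  have "(\<integral>\<^sup>+x. ennreal (- ln (sin x)) \<partial>lborel_on 0 (pi / 2)) \<le>
        (\<integral>\<^sup>+x. ennreal (ln 2 - ln x) \<partial>lborel_on 0 (pi / 2))"
  proof (rule nn_integral_lborel_on_mono, rule ennreal_leI)
    fix x :: real assume x: "0 < x" "x < pi / 2"
    then have "ln (x / 2) \<le> ln (sin x)"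
      using half_le_sin[of x] by (intro ln_mono) auto
    then show "- ln (sin x) \<le> ln 2 - ln x"
      using x by (simp add: ln_div)
  qed
  also have "(\<integral>\<^sup>+x. ennreal (ln 2 - ln x) \<partial>lborel_on 0 (pi / 2)) = ennreal (?F (pi / 2) - ?F 0)"
  proof (rule nn_integral_lborel_on_FTC)
    show "continuous_on {0..pi / 2} ?F"
      by (intro continuous_intros continuous_on_mult_ln)
    show "(?F has_real_derivative ln 2 - ln x) (at x)" if "0 < x" for x
      using that by (auto intro!: derivative_eq_intros)
    show "0 \<le> ln 2 - ln x" if "0 < x" "x < pi / 2" for x :: real
      using that pi_half_less_two by simp
  qed auto
  finally show ?thesis
    by (rule le_less_trans) simp
qed

lemma nn_integral_ln_cos_eq_sin:
  "(\<integral>\<^sup>+x. ennreal (- ln (cos x)) \<partial>lborel_on 0 (pi / 2)) =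
   (\<integral>\<^sup>+x. ennreal (- ln (sin x)) \<partial>lborel_on 0 (pi / 2))"
  using nn_integral_lborel_on_reflect[of "\<lambda>x. ennreal (- ln (cos x))" "pi / 2" "pi / 2" 0]
  by (simp add: cos_diff)

text \<open>
  Euler's duplication argument: \<open>sin (2 x) = 2 sin x cos x\<close> yields \<open>2 s = (\<pi>/2) ln 2 + s\<close> for the
  integral \<open>s\<close>, and finiteness allows \<open>s\<close> to be cancelled. It says that \<open>1 + x\<close> has Mahler measure \<open>0\<close>.
\<close>

lemma nn_integral_ln_sin: "(\<integral>\<^sup>+x. ennreal (- ln (sin x)) \<partial>lborel_on 0 (pi / 2)) = ennreal (pi / 2 * ln 2)"
proof -
  let ?s = "\<integral>\<^sup>+x. ennreal (- ln (sin x)) \<partial>lborel_on 0 (pi / 2)"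
  have double: "(\<integral>\<^sup>+x. ennreal (- ln (sin (2 * x))) \<partial>lborel_on 0 (pi / 2)) = ?s"
  proof -
    have "2 * (\<integral>\<^sup>+x. ennreal (- ln (sin (2 * x))) \<partial>lborel_on 0 (pi / 2)) =
          (\<integral>\<^sup>+x. ennreal (- ln (sin x)) \<partial>lborel_on 0 (2 * (pi / 2)))"
      using nn_integral_lborel_on_affine[of "\<lambda>x. ennreal (- ln (sin x))" 2 0 0 "pi / 2"] by simp
    also have "\<dots> = 2 * ?s"
      by (rule nn_integral_lborel_on_symmetric) (auto simp: sin_diff)
    finally show ?thesis
      by (simp add: ennreal_mult_cancel_left)
  qed
  have "?s + ?s = (\<integral>\<^sup>+x. ennreal (- ln (sin x)) + ennreal (- ln (cos x)) \<partial>lborel_on 0 (pi / 2))"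
    by (subst nn_integral_add) (auto simp: nn_integral_ln_cos_eq_sin)
  also have "\<dots> = (\<integral>\<^sup>+x. ennreal (ln 2) + ennreal (- ln (sin (2 * x))) \<partial>lborel_on 0 (pi / 2))"
  proof (rule nn_integral_lborel_on_cong)
    fix x :: real assume x: "0 < x" "x < pi / 2"
    then have pos: "0 < sin x" "0 < cos x"
      by (auto intro: sin_gt_zero cos_gt_zero)
    then have "0 \<le> - ln (sin x)" "0 \<le> - ln (cos x)" "0 \<le> - ln (sin (2 * x))"
      using x by (auto simp: sin_gt_zero)
    moreover have "- ln (sin x) + - ln (cos x) = ln 2 + - ln (sin (2 * x))"
      using pos by (simp add: sin_double ln_mult)
    ultimately show "ennreal (- ln (sin x)) + ennreal (- ln (cos x)) = ennreal (ln 2) + ennreal (- ln (sin (2 * x)))"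
      by (simp flip: ennreal_plus)
  qed
  also have "\<dots> = ennreal (ln 2) * ennreal (pi / 2) + ?s"
    by (subst nn_integral_add) (auto simp: double)
  also have "ennreal (ln 2) * ennreal (pi / 2) = ennreal (pi / 2 * ln 2)"
    by (simp add: mult.commute flip: ennreal_mult)
  finally show ?thesis
    using nn_integral_ln_sin_finite by (auto simp: ennreal_add_left_cancel add.commute)
qed

section \<open>Jensen's formula for linear polynomials\<close>

text \<open>
  The mean value property of the harmonic function \<open>u \<mapsto> ln \<bar>1 + q u\<bar>\<close>, which is the real part of
  a function holomorphic on the closed unit disc and vanishing at \<open>0\<close>.
\<close>

lemma has_integral_ln_cmod_one_plus:
  assumes "cmod q < 1"
  shows "((\<lambda>t. ln (cmod (1 + q * cis t))) has_integral 0) {0..2 * pi}"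
proof -
  let ?f = "\<lambda>u. Ln (1 + q * u)"
  have pos: "0 < Re (1 + q * u)" if "cmod u \<le> 1" for u
  proof -
    have "cmod (q * u) < 1"
      using assms that mult_mono[of "cmod q" "cmod q" "cmod u" 1] by (auto simp: norm_mult)
    then show ?thesis
      using abs_Re_le_cmod[of "q * u"] by auto
  qed
  then have nz: "1 + q * u \<notin> \<real>\<^sub>\<le>\<^sub>0" if "cmod u \<le> 1" for u
    using that by (auto simp: complex_nonpos_Reals_iff dest!: pos)
  have "?f holomorphic_on cball 0 1"
    by (intro holomorphic_intros) (use nz in auto)
  then have "((\<lambda>u. ?f u / (u - 0)) has_contour_integral (2 * of_real pi * \<i> * ?f 0)) (circlepath 0 1)"
    by (intro Cauchy_integral_circlepath_simple) auto
  then have "((\<lambda>t. ?f (cis t) * \<i>) has_integral 0) {0..2 * pi}"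
    by (simp add: circlepath_def has_contour_integral_part_circlepath_iff)
  from has_integral_linear[OF this bounded_linear_Im]
  have "((\<lambda>t. Re (?f (cis t))) has_integral 0) {0..2 * pi}"
    by (simp add: o_def)
  moreover have "Re (?f (cis t)) = ln (cmod (1 + q * cis t))" for t
  proof -
    have "1 + q * cis t \<noteq> 0"
      using pos[of "cis t"] by (metis norm_cis order_refl less_irrefl zero_complex.sel(1))
    then show ?thesis by (rule Re_Ln)
  qed
  ultimately show ?thesis
    by simp
qed

text \<open>
  Jensen's formula for a linear polynomial. If the coefficient of \<open>cis t\<close> dominates, conjugation
  and multiplication by \<open>cis t\<close> exchange the two coefficients without changing the modulus. The
  case of equal moduli will only occur on a null set.
\<close>

lemma has_integral_ln_cmod_linear:
  assumes "cmod a \<noteq> cmod b"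
  shows "((\<lambda>t. ln (cmod (a + b * cis t))) has_integral (2 * pi * ln (max (cmod a) (cmod b)))) {0..2 * pi}"
proof -
  have *: "((\<lambda>t. ln (cmod c) + ln (cmod (1 + d / c * cis t))) has_integral (2 * pi * ln (cmod c))) {0..2 * pi}"
    if "cmod d < cmod c" for c d
  proof -
    have "cmod (d / c) < 1"
      using that by (auto simp: norm_divide divide_simps)
    from has_integral_add[OF has_integral_const_real[of "ln (cmod c)" 0 "2 * pi"] has_integral_ln_cmod_one_plus[OF this]]
    show ?thesis
      by simp
  qed
  have split: "ln (cmod (c + d * cis t)) = ln (cmod c) + ln (cmod (1 + d / c * cis t))"
    if "cmod d < cmod c" for c d t
  proof -
    have "c \<noteq> 0" using that by auto
    moreover have "1 + d / c * cis t \<noteq> 0"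
    proof
      assume "1 + d / c * cis t = 0"
      then have "d / c * cis t = - 1"
        by (simp only: eq_neg_iff_add_eq_0 add.commute)
      then have "cmod (d / c * cis t) = cmod (- 1)"
        by (simp only:)
      then show False
        using that by (auto simp: norm_mult norm_divide)
    qed
    moreover have "c + d * cis t = c * (1 + d / c * cis t)"
      using \<open>c \<noteq> 0\<close> by (simp add: field_simps)
    ultimately show ?thesis
      by (simp add: norm_mult ln_mult)
  qed
  have conj: "cmod (a + b * cis t) = cmod (cnj b + cnj a * cis t)" for t
  proof -
    have "cmod (a + b * cis t) = cmod (cnj (a + b * cis t) * cis t)"
      by (simp only: norm_mult norm_cis complex_mod_cnj mult_1_right)
    also have "cnj (a + b * cis t) * cis t = cnj b + cnj a * cis t"
      by (simp add: distrib_right cis_cnj cis_mult mult.assoc)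
    finally show ?thesis .
  qed
  show ?thesis
  proof (cases "cmod b < cmod a")
    case True
    then show ?thesis
      using *[OF True] by (simp add: split[OF True] max_def)
  next
    case False
    then have "cmod (cnj a) < cmod (cnj b)" using assms by simp
    then show ?thesis
      using *[of "cnj a" "cnj b"] False by (simp add: split[of "cnj a" "cnj b"] conj max_def)
  qed
qed

lemma nn_integral_ln_cmod_linear:
  assumes ne: "cmod a \<noteq> cmod b" and K: "cmod a + cmod b \<le> exp K"
  shows "(\<integral>\<^sup>+t. ennreal (K - ln (cmod (a + b * cis t))) \<partial>lborel_on 0 (2 * pi)) =
         ennreal (2 * pi * (K - ln (max (cmod a) (cmod b))))"
proof (rule nn_integral_lborel_on_has_integral)
  show "((\<lambda>t. K - ln (cmod (a + b * cis t))) has_integral 2 * pi * (K - ln (max (cmod a) (cmod b)))) {0..2 * pi}"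
    using has_integral_diff[OF has_integral_const_real[of K 0 "2 * pi"] has_integral_ln_cmod_linear[OF ne]]
    by (simp add: algebra_simps)
  show "0 \<le> K - ln (cmod (a + b * cis t))" for t
  proof -
    have "a + b * cis t \<noteq> 0"
    proof
      assume "a + b * cis t = 0"
      then have "a = - (b * cis t)"
        by (simp add: eq_neg_iff_add_eq_0)
      then have "cmod a = cmod (b * cis t)"
        by (simp only: norm_minus_cancel)
      then show False using ne by (simp add: norm_mult)
    qed
    moreover have "cmod (a + b * cis t) \<le> exp K"
      using norm_triangle_ineq[of a "b * cis t"] K by (simp add: norm_mult)
    ultimately show ?thesis
      using ln_le_cancel_iff[of "cmod (a + b * cis t)" "exp K"] by simp
  qed
qed measurable

section \<open>The positive logarithm of a ratio of cosines\<close>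

lemma nn_integral_even_power_series:
  fixes c :: "nat \<Rightarrow> real"
  assumes c: "\<And>n. 0 \<le> c n" and "0 \<le> v"
  shows "(\<integral>\<^sup>+u. suminf (\<lambda>n. ennreal (c n * u ^ (2 * n))) \<partial>lborel_on 0 v) =
         suminf (\<lambda>n. ennreal (c n * v ^ (2 * n + 1) / real (2 * n + 1)))"
proof -
  have "(\<integral>\<^sup>+u. ennreal (c n * u ^ (2 * n)) \<partial>lborel_on 0 v) = ennreal (c n * v ^ (2 * n + 1) / real (2 * n + 1))" for n
  proof -
    let ?F = "\<lambda>u. c n * u ^ (2 * n + 1) / real (2 * n + 1)"
    have "(\<integral>\<^sup>+u. ennreal (c n * u ^ (2 * n)) \<partial>lborel_on 0 v) = ennreal (?F v - ?F 0)"
    proof (rule nn_integral_lborel_on_FTC)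
      show "(?F has_real_derivative c n * u ^ (2 * n)) (at u)" for u
      proof -
        have "((\<lambda>u. c n / real (2 * n + 1) * u ^ (2 * n + 1)) has_real_derivative
            c n / real (2 * n + 1) * (real (2 * n + 1) * u ^ (2 * n + 1 - Suc 0))) (at u)"
          by (intro DERIV_cmult DERIV_pow)
        then show ?thesis
          by (simp del: of_nat_add of_nat_Suc of_nat_mult)
      qed
    qed (use assms in \<open>auto intro!: continuous_intros mult_nonneg_nonneg\<close>)
    then show ?thesis by simp
  qed
  then show ?thesis
    by (subst nn_integral_suminf) auto
qed

text \<open>
  The left-hand side is \<open>artanh v / v\<close>; its series comes from integrating the geometric series
  of \<open>1 / (1 - u\<^sup>2)\<close>.
\<close>

lemma ennreal_artanh_series:
  fixes v :: real
  assumes "0 < v" "v < 1"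
  shows "ennreal ((ln (1 + v) - ln (1 - v)) / (2 * v)) = suminf (\<lambda>n. ennreal (v ^ (2 * n) / real (2 * n + 1)))"
proof -
  let ?F = "\<lambda>u::real. (ln (1 + u) - ln (1 - u)) / 2"
  have "ennreal (?F v - ?F 0) = (\<integral>\<^sup>+u. ennreal (1 / (1 - u\<^sup>2)) \<partial>lborel_on 0 v)"
  proof (rule nn_integral_lborel_on_FTC[symmetric])
    show "continuous_on {0..v} ?F"
      using assms by (intro continuous_intros) auto
    show "(?F has_real_derivative 1 / (1 - u\<^sup>2)) (at u)" if u: "0 < u" "u < v" for u
    proof -
      have "1 - u\<^sup>2 = (1 + u) * (1 - u)" by (simp add: power2_eq_square algebra_simps)
      moreover have "(?F has_real_derivative (1 / (1 + u) + 1 / (1 - u)) / 2) (at u)"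
        using u assms by (auto intro!: derivative_eq_intros)
      moreover have "(1 / (1 + u) + 1 / (1 - u)) / 2 = 1 / ((1 + u) * (1 - u))"
        using u assms by (simp add: add_frac_eq)
      ultimately show ?thesis by simp
    qed
    show "0 \<le> 1 / (1 - u\<^sup>2)" if "0 < u" "u < v" for u
      using that assms by (auto simp: power_le_one)
  qed (use assms in auto)
  also have "\<dots> = (\<integral>\<^sup>+u. suminf (\<lambda>n. ennreal (1 * u ^ (2 * n))) \<partial>lborel_on 0 v)"
  proof (rule nn_integral_lborel_on_cong)
    fix u :: real assume u: "0 < u" "u < v"
    then have "u\<^sup>2 < 1"
      using assms by (simp add: power_less_one_iff)
    then have "(\<lambda>n. (u\<^sup>2) ^ n) sums (1 / (1 - u\<^sup>2))"
      by (intro geometric_sums) simp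
    then show "ennreal (1 / (1 - u\<^sup>2)) = suminf (\<lambda>n. ennreal (1 * u ^ (2 * n)))"
      by (subst suminf_ennreal_eq) (auto simp: power_mult)
  qed
  also have "\<dots> = suminf (\<lambda>n. ennreal (v ^ (2 * n + 1) / real (2 * n + 1)))"
    using assms by (subst nn_integral_even_power_series[where c = "\<lambda>_. 1"]) auto
  finally have "ennreal (1 / v) * ennreal (?F v) = ennreal (1 / v) * \<dots>"
    by simp
  also have "ennreal (1 / v) * ennreal (?F v) = ennreal ((ln (1 + v) - ln (1 - v)) / (2 * v))"
    using assms by (subst ennreal_mult[symmetric]) (auto simp: field_simps)
  also have "ennreal (1 / v) * suminf (\<lambda>n. ennreal (v ^ (2 * n + 1) / real (2 * n + 1))) =
      suminf (\<lambda>n. ennreal (v ^ (2 * n) / real (2 * n + 1)))"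
    unfolding ennreal_suminf_cmult[symmetric] using assms
    by (intro suminf_cong) (subst ennreal_mult[symmetric]; auto simp: field_simps)
  finally show ?thesis .
qed

text \<open>
  The substitution \<open>u = sin x\<close> turns the integrand into \<open>1 / sqrt (1 - v\<^sup>2 + v\<^sup>2 u\<^sup>2)\<close>, hence the
  logarithmic (inverse hyperbolic sine) antiderivative.
\<close>

lemma nn_integral_cos_div_sqrt:
  assumes "0 < v" "v < 1"
  shows "(\<integral>\<^sup>+x. ennreal (cos x / sqrt (1 - (v * cos x)\<^sup>2)) \<partial>lborel_on 0 (pi / 2)) =
         ennreal ((ln (1 + v) - ln (1 - v)) / (2 * v))"
proof -
  \<comment> \<open>\<open>R\<close> is written with \<open>cos\<close>, but equals \<open>sqrt (1 - v\<^sup>2 + v\<^sup>2 sin\<^sup>2 x)\<close>.\<close>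
  define R where "R = (\<lambda>x. sqrt (1 - (v * cos x)\<^sup>2))"
  let ?F = "\<lambda>x. ln (v * sin x + R x) / v"
  have less: "(v * cos x)\<^sup>2 < 1" for x
  proof -
    have "\<bar>v * cos x\<bar> \<le> v * 1"
      unfolding abs_mult using assms by (intro mult_mono) auto
    then show ?thesis
      using assms by (simp add: abs_square_less_1)
  qed
  then have Rpos: "0 < R x" for x
    by (simp add: R_def)
  have pos: "0 < v * sin x + R x" if "0 \<le> x" "x \<le> pi / 2" for x
    using assms that Rpos[of x] by (intro add_nonneg_pos mult_nonneg_nonneg sin_ge_zero) auto
  have "(\<integral>\<^sup>+x. ennreal (cos x / sqrt (1 - (v * cos x)\<^sup>2)) \<partial>lborel_on 0 (pi / 2)) = ennreal (?F (pi / 2) - ?F 0)"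
  proof (rule nn_integral_lborel_on_FTC)
    have "continuous_on {0..pi / 2} R"
      unfolding R_def by (intro continuous_intros)
    moreover have "\<forall>x\<in>{0..pi / 2}. v * sin x + R x \<noteq> 0"
      using pos by (metis atLeastAtMost_iff less_irrefl)
    ultimately show "continuous_on {0..pi / 2} ?F"
      using assms by (intro continuous_intros) auto
    fix x :: real assume x: "0 < x" "x < pi / 2"
    show "0 \<le> cos x / sqrt (1 - (v * cos x)\<^sup>2)"
      using x less[of x] by (auto intro!: divide_nonneg_nonneg cos_ge_zero)
    have R': "(R has_real_derivative (v\<^sup>2 * cos x * sin x / R x)) (at x)"
      unfolding R_def using Rpos[of x] less[of x]
      by (auto intro!: derivative_eq_intros simp: R_def field_simps power2_eq_square)
    have "(?F has_real_derivative (v * cos x + v\<^sup>2 * cos x * sin x / R x) / (v * sin x + R x) / v) (at x)"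
      using pos[of x] x assms by (auto intro!: derivative_eq_intros R')
    also have "v * cos x + v\<^sup>2 * cos x * sin x / R x = v * cos x / R x * (v * sin x + R x)"
      using Rpos[of x] by (simp add: field_simps power2_eq_square)
    also have "\<dots> / (v * sin x + R x) / v = cos x / R x"
      using pos[of x] x assms by simp
    finally show "(?F has_real_derivative cos x / sqrt (1 - (v * cos x)\<^sup>2)) (at x)"
      by (simp add: R_def)
  qed auto
  also have "?F (pi / 2) - ?F 0 = (ln (1 + v) - ln (1 - v)) / (2 * v)"
  proof -
    have "1 - v\<^sup>2 = (1 + v) * (1 - v)" by (simp add: power2_eq_square algebra_simps)
    then have "ln (sqrt (1 - v\<^sup>2)) = (ln (1 + v) + ln (1 - v)) / 2"
      using assms by (simp add: ln_sqrt ln_mult)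
    then show ?thesis
      using assms by (simp add: R_def field_simps)
  qed
  finally show ?thesis .
qed

text \<open>
  Differentiating under the integral sign in \<open>s\<close> reduces this to the previous integral; in terms of
  nonnegative integrals, this is an exchange of the order of integration.
\<close>

lemma nn_integral_arcsin_cos:
  assumes "0 < s" "s < 1"
  shows "(\<integral>\<^sup>+x. ennreal (arcsin (s * cos x)) \<partial>lborel_on 0 (pi / 2)) =
         suminf (\<lambda>n. ennreal (s ^ (2 * n + 1) / real (2 * n + 1) ^ 2))"
proof -
  have "(\<integral>\<^sup>+x. ennreal (arcsin (s * cos x)) \<partial>lborel_on 0 (pi / 2)) =
    (\<integral>\<^sup>+x. \<integral>\<^sup>+v. ennreal (cos x / sqrt (1 - (v * cos x)\<^sup>2)) \<partial>lborel_on 0 s \<partial>lborel_on 0 (pi / 2))"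
  proof (rule nn_integral_lborel_on_cong)
    fix x assume x: "0 < x" "x < pi / 2"
    have c: "0 < cos x" using x by (intro cos_gt_zero) auto
    have b: "v * cos x < 1" if "0 \<le> v" "v \<le> s" for v
      using mult_mono[of v s "cos x" 1] that assms c by auto
    have "(\<integral>\<^sup>+v. ennreal (cos x / sqrt (1 - (v * cos x)\<^sup>2)) \<partial>lborel_on 0 s) =
        ennreal (arcsin (s * cos x) - arcsin (0 * cos x))"
    proof (rule nn_integral_lborel_on_FTC)
      show "continuous_on {0..s} (\<lambda>v. arcsin (v * cos x))"
        using b c by (intro continuous_intros) (auto simp: less_imp_le intro: order_trans[of _ 0])
      fix v assume v: "0 < v" "v < s"
      have "0 < v * cos x" using v c by simp
      with b[of v] v show "((\<lambda>v. arcsin (v * cos x)) has_real_derivative cos x / sqrt (1 - (v * cos x)\<^sup>2)) (at v)"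
        by (auto intro!: derivative_eq_intros simp: divide_inverse)
      show "0 \<le> cos x / sqrt (1 - (v * cos x)\<^sup>2)"
        using c b[of v] v \<open>0 < v * cos x\<close> by (auto intro!: divide_nonneg_nonneg simp: power_le_one)
    qed (use assms in auto)
    then show "ennreal (arcsin (s * cos x)) = (\<integral>\<^sup>+v. ennreal (cos x / sqrt (1 - (v * cos x)\<^sup>2)) \<partial>lborel_on 0 s)"
      by simp
  qed
  also have "\<dots> = (\<integral>\<^sup>+v. \<integral>\<^sup>+x. ennreal (cos x / sqrt (1 - (v * cos x)\<^sup>2)) \<partial>lborel_on 0 (pi / 2) \<partial>lborel_on 0 s)"
    by (rule nn_integral_lborel_on_swap) measurable
  also have "\<dots> = (\<integral>\<^sup>+v. suminf (\<lambda>n. ennreal (1 / real (2 * n + 1) * v ^ (2 * n))) \<partial>lborel_on 0 s)"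
  proof (rule nn_integral_lborel_on_cong)
    fix v assume v: "0 < v" "v < s"
    then have "v < 1" using assms by simp
    then show "(\<integral>\<^sup>+x. ennreal (cos x / sqrt (1 - (v * cos x)\<^sup>2)) \<partial>lborel_on 0 (pi / 2)) =
        suminf (\<lambda>n. ennreal (1 / real (2 * n + 1) * v ^ (2 * n)))"
      unfolding nn_integral_cos_div_sqrt[OF v(1) \<open>v < 1\<close>] ennreal_artanh_series[OF v(1) \<open>v < 1\<close>]
      by simp
  qed
  also have "\<dots> = suminf (\<lambda>n. ennreal (1 / real (2 * n + 1) * s ^ (2 * n + 1) / real (2 * n + 1)))"
    using assms by (intro nn_integral_even_power_series) auto
  finally show ?thesis
    by (simp add: power2_eq_square)
qed

text \<open>
  Since \<open>\<bar>1 + cis (2 x)\<bar> = 2 \<bar>cos x\<bar>\<close>, Jensen's formula identifies this number, divided by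
  \<open>(\<pi>/2)\<^sup>2\<close>, with the Mahler measure of \<open>r (1 + x) + (1 + y) z\<close>.
\<close>

definition cos_ratio_integral :: "real \<Rightarrow> ennreal" where
  "cos_ratio_integral r =
     (\<integral>\<^sup>+x. \<integral>\<^sup>+y. ennreal (max 0 (ln (r * cos x / cos y))) \<partial>lborel_on 0 (pi / 2) \<partial>lborel_on 0 (pi / 2))"

text \<open>
  Replacing the positive part of the logarithm by an integral over levels \<open>s\<close> leaves, for each level,
  only the measure of the set where \<open>cos y < s cos x\<close>, which is an arcsine.
\<close>

lemma max_ln_layer_cake:
  assumes "0 < c" "0 < d" "0 < r"
  shows "ennreal (max 0 (ln (r * c / d))) = (\<integral>\<^sup>+s. ennreal (1 / s) * indicator {d<..} (s * c) \<partial>lborel_on 0 r)"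
proof (cases "d / c < r")
  case True
  have "(\<integral>\<^sup>+s. ennreal (1 / s) * indicator {d<..} (s * c) \<partial>lborel_on 0 r) =
      (\<integral>\<^sup>+s. ennreal (1 / s) * indicator {d<..} (s * c) \<partial>lborel_on 0 (d / c)) +
      (\<integral>\<^sup>+s. ennreal (1 / s) * indicator {d<..} (s * c) \<partial>lborel_on (d / c) r)"
    using assms True by (intro nn_integral_lborel_on_split) auto
  also have "(\<integral>\<^sup>+s. ennreal (1 / s) * indicator {d<..} (s * c) \<partial>lborel_on 0 (d / c)) =
      (\<integral>\<^sup>+s. 0 \<partial>lborel_on 0 (d / c))"
    using assms by (intro nn_integral_lborel_on_cong) (auto simp: field_simps)
  also have "(\<integral>\<^sup>+s. ennreal (1 / s) * indicator {d<..} (s * c) \<partial>lborel_on (d / c) r) =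
      (\<integral>\<^sup>+s. ennreal (1 / s) \<partial>lborel_on (d / c) r)"
    using assms by (intro nn_integral_lborel_on_cong) (auto simp: field_simps)
  also have "\<dots> = ennreal (ln r - ln (d / c))"
  proof (rule nn_integral_lborel_on_FTC)
    have dc: "0 < d / c" using assms by simp
    show "continuous_on {d / c..r} ln"
      using dc by (intro continuous_intros) auto
    fix s assume "d / c < s"
    with dc have s: "0 < s" by linarith
    then show "(ln has_real_derivative 1 / s) (at s)" "0 \<le> 1 / s"
      by (auto intro!: derivative_eq_intros)
  qed (use True in auto)
  also have "ln r - ln (d / c) = max 0 (ln (r * c / d))"
  proof -
    have "1 < r * c / d" using True assms by (simp add: field_simps)
    then have "0 < ln (r * c / d)" by (rule ln_gt_zero)
    then show ?thesis using assms by (simp add: ln_mult ln_div)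
  qed
  finally show ?thesis by simp
next
  case False
  then have "r * c \<le> d"
    using assms by (simp add: field_simps)
  have "(\<integral>\<^sup>+s. ennreal (1 / s) * indicator {d<..} (s * c) \<partial>lborel_on 0 r) = (\<integral>\<^sup>+s. 0 \<partial>lborel_on 0 r)"
  proof (rule nn_integral_lborel_on_cong)
    fix s assume "0 < s" "s < r"
    then have "s * c < r * c" using assms by simp
    then show "ennreal (1 / s) * indicator {d<..} (s * c) = 0"
      using \<open>r * c \<le> d\<close> by (simp add: indicator_def)
  qed
  moreover have "ln (r * c / d) \<le> 0"
    using False assms by (simp add: field_simps)
  ultimately show ?thesis by simp
qed

lemma nn_integral_indicator_cos_less:
  assumes "0 < c" "c < 1"
  shows "(\<integral>\<^sup>+y. indicator {cos y<..} c \<partial>lborel_on 0 (pi / 2)) = ennreal (arcsin c)"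
proof -
  have ac: "0 < arccos c" "arccos c < pi / 2"
    using assms arccos_lt_bounded[of c] arccos_less_arccos[of 0 c] by auto
  have "(\<integral>\<^sup>+y. indicator {cos y<..} c \<partial>lborel_on 0 (pi / 2)) =
     (\<integral>\<^sup>+y. indicator {cos y<..} c \<partial>lborel_on 0 (arccos c)) + (\<integral>\<^sup>+y. indicator {cos y<..} c \<partial>lborel_on (arccos c) (pi / 2))"
    using ac by (intro nn_integral_lborel_on_split) (auto simp: indicator_def)
  also have "(\<integral>\<^sup>+y. indicator {cos y<..} c \<partial>lborel_on 0 (arccos c)) = (\<integral>\<^sup>+y. 0 \<partial>lborel_on 0 (arccos c))"
  proof (rule nn_integral_lborel_on_cong)
    fix y assume "0 < y" "y < arccos c"
    then have "cos (arccos c) < cos y"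
      using ac by (intro cos_monotone_0_pi) auto
    then show "indicator {cos y<..} c = (0::ennreal)"
      using assms by (simp add: indicator_def)
  qed
  also have "(\<integral>\<^sup>+y. indicator {cos y<..} c \<partial>lborel_on (arccos c) (pi / 2)) = (\<integral>\<^sup>+y. 1 \<partial>lborel_on (arccos c) (pi / 2))"
  proof (rule nn_integral_lborel_on_cong)
    fix y assume "arccos c < y" "y < pi / 2"
    then have "cos y < cos (arccos c)"
      using ac by (intro cos_monotone_0_pi) auto
    then show "indicator {cos y<..} c = (1::ennreal)"
      using assms by (simp add: indicator_def)
  qed
  also have "(\<integral>\<^sup>+y. 0 \<partial>lborel_on 0 (arccos c)) + (\<integral>\<^sup>+y. 1 \<partial>lborel_on (arccos c) (pi / 2)) = ennreal (pi / 2 - arccos c)"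
    using ac by simp
  finally show ?thesis
    using assms by (simp add: arccos_arcsin_eq)
qed

text \<open>
  Each of the three integrations (the one inside arcsin, the one inside artanh, and the layer cake)
  contributes one factor \<open>1 / (2 n + 1)\<close>.
\<close>

lemma cos_ratio_integral_series:
  assumes "0 < r" "r < 1"
  shows "cos_ratio_integral r = suminf (\<lambda>n. ennreal (r ^ (2 * n + 1) / real (2 * n + 1) ^ 3))"
proof -
  let ?L = "lborel_on 0 (pi / 2)"
  have "cos_ratio_integral r = (\<integral>\<^sup>+x. \<integral>\<^sup>+y. \<integral>\<^sup>+s. ennreal (1 / s) * indicator {cos y<..} (s * cos x) \<partial>lborel_on 0 r \<partial>?L \<partial>?L)"
    unfolding cos_ratio_integral_def using assms
    by (intro nn_integral_lborel_on_cong max_ln_layer_cake cos_gt_zero) auto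
  also have "\<dots> = (\<integral>\<^sup>+x. \<integral>\<^sup>+s. \<integral>\<^sup>+y. ennreal (1 / s) * indicator {cos y<..} (s * cos x) \<partial>?L \<partial>lborel_on 0 r \<partial>?L)"
    by (intro nn_integral_cong nn_integral_lborel_on_swap) (simp add: indicator_def)
  also have "\<dots> = (\<integral>\<^sup>+s. \<integral>\<^sup>+x. \<integral>\<^sup>+y. ennreal (1 / s) * indicator {cos y<..} (s * cos x) \<partial>?L \<partial>?L \<partial>lborel_on 0 r)"
    by (intro nn_integral_lborel_on_swap) (simp add: indicator_def)
  also have "\<dots> = (\<integral>\<^sup>+s. suminf (\<lambda>n. ennreal (1 / real (2 * n + 1) ^ 2 * s ^ (2 * n))) \<partial>lborel_on 0 r)"
  proof (rule nn_integral_lborel_on_cong)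
    fix s assume s: "0 < s" "s < r"
    have "(\<integral>\<^sup>+x. \<integral>\<^sup>+y. ennreal (1 / s) * indicator {cos y<..} (s * cos x) \<partial>?L \<partial>?L) =
          (\<integral>\<^sup>+x. ennreal (1 / s) * ennreal (arcsin (s * cos x)) \<partial>?L)"
    proof (rule nn_integral_lborel_on_cong)
      fix x assume x: "0 < x" "x < pi / 2"
      then have "0 < cos x" by (intro cos_gt_zero) auto
      moreover have "s * cos x < 1"
        using s assms mult_left_mono[of "cos x" 1 s] cos_le_one[of x] by linarith
      ultimately show "(\<integral>\<^sup>+y. ennreal (1 / s) * indicator {cos y<..} (s * cos x) \<partial>?L) =
          ennreal (1 / s) * ennreal (arcsin (s * cos x))"
        using s assms
        by (subst nn_integral_cmult, simp add: indicator_def) (simp add: nn_integral_indicator_cos_less)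
    qed
    also have "\<dots> = ennreal (1 / s) * suminf (\<lambda>n. ennreal (s ^ (2 * n + 1) / real (2 * n + 1) ^ 2))"
    proof -
      have "\<bar>s * cos x\<bar> \<le> 1" for x
        unfolding abs_mult using s assms mult_mono[of "\<bar>s\<bar>" 1 "\<bar>cos x\<bar>" 1] by simp
      then have "continuous_on UNIV (\<lambda>x. arcsin (s * cos x))"
        by (intro continuous_intros) (auto simp: abs_le_iff)
      then have "(\<lambda>x. arcsin (s * cos x)) \<in> borel_measurable borel"
        by (rule borel_measurable_continuous_onI)
      then have "(\<lambda>x. ennreal (arcsin (s * cos x))) \<in> borel_measurable ?L"
        by measurable
      moreover have "s < 1" using s assms by simp
      ultimately show ?thesis
        by (simp only: nn_integral_cmult nn_integral_arcsin_cos[OF s(1)])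
    qed
    also have "\<dots> = suminf (\<lambda>n. ennreal (1 / real (2 * n + 1) ^ 2 * s ^ (2 * n)))"
      unfolding ennreal_suminf_cmult[symmetric] using s
      by (intro suminf_cong) (subst ennreal_mult[symmetric]; auto simp: field_simps)
    finally show "(\<integral>\<^sup>+x. \<integral>\<^sup>+y. ennreal (1 / s) * indicator {cos y<..} (s * cos x) \<partial>?L \<partial>?L) =
      suminf (\<lambda>n. ennreal (1 / real (2 * n + 1) ^ 2 * s ^ (2 * n)))" .
  qed
  also have "\<dots> = suminf (\<lambda>n. ennreal (1 / real (2 * n + 1) ^ 2 * r ^ (2 * n + 1) / real (2 * n + 1)))"
    using assms by (intro nn_integral_even_power_series) auto
  finally show ?thesis
    by (simp add: power3_eq_cube power2_eq_square)
qed

text \<open>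
  This is \<open>max 0 (ln u) = ln u + max 0 (ln (1/u))\<close> for \<open>u = cos x / (r cos y)\<close>, because
  \<open>ln (cos x)\<close> and \<open>ln (cos y)\<close> have the same integral. Adding \<open>- ln (cos x)\<close> on both sides
  keeps all integrands nonnegative.
\<close>

lemma cos_ratio_integral_inverse:
  assumes "0 < r" "r < 1"
  shows "cos_ratio_integral (1 / r) = ennreal ((pi / 2)\<^sup>2 * (- ln r)) + cos_ratio_integral r"
proof -
  let ?L = "lborel_on 0 (pi / 2)"
  let ?c = "ennreal (pi / 2) * ennreal (pi / 2 * ln 2)"
  have c: "(\<integral>\<^sup>+x. ennreal (- ln (cos x)) \<partial>?L) = ennreal (pi / 2 * ln 2)"
    using nn_integral_ln_sin by (simp add: nn_integral_ln_cos_eq_sin)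
  have swap: "(\<integral>\<^sup>+x. \<integral>\<^sup>+y. ennreal (max 0 (ln (r * cos y / cos x))) \<partial>?L \<partial>?L) = cos_ratio_integral r"
    unfolding cos_ratio_integral_def by (rule nn_integral_lborel_on_swap) measurable
  have "cos_ratio_integral (1 / r) + ?c =
      (\<integral>\<^sup>+x. \<integral>\<^sup>+y. ennreal (max 0 (ln (1 / r * cos x / cos y))) + ennreal (- ln (cos x)) \<partial>?L \<partial>?L)"
    by (simp add: nn_integral_add cos_ratio_integral_def nn_integral_multc c mult.commute)
  also have "\<dots> = (\<integral>\<^sup>+x. \<integral>\<^sup>+y. ennreal (- ln r) + ennreal (max 0 (ln (r * cos y / cos x))) + ennreal (- ln (cos y)) \<partial>?L \<partial>?L)"
  proof (intro nn_integral_lborel_on_cong)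
    fix x y :: real assume xy: "0 < x" "x < pi / 2" "0 < y" "y < pi / 2"
    then have pos: "0 < cos x" "0 < cos y"
      by (auto intro: cos_gt_zero)
    have "ln (1 / r * cos x / cos y) = - ln r + ln (cos x) - ln (cos y)"
      "ln (r * cos y / cos x) = ln r + ln (cos y) - ln (cos x)"
      using pos assms by (simp_all add: ln_mult ln_div)
    then have "max 0 (ln (1 / r * cos x / cos y)) + - ln (cos x) =
       - ln r + max 0 (ln (r * cos y / cos x)) + - ln (cos y)"
      by (simp add: max_def)
    moreover have "0 \<le> - ln (cos x)" "0 \<le> - ln (cos y)" "0 \<le> - ln r"
      using pos assms by auto
    ultimately show "ennreal (max 0 (ln (1 / r * cos x / cos y))) + ennreal (- ln (cos x)) =
      ennreal (- ln r) + ennreal (max 0 (ln (r * cos y / cos x))) + ennreal (- ln (cos y))"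
      by (simp flip: ennreal_plus)
  qed
  also have "\<dots> = ennreal (- ln r) * ennreal (pi / 2) * ennreal (pi / 2) + cos_ratio_integral r + ?c"
    by (simp add: nn_integral_add c swap mult.commute)
  also have "ennreal (- ln r) * ennreal (pi / 2) * ennreal (pi / 2) = ennreal ((pi / 2)\<^sup>2 * (- ln r))"
  proof -
    have "ennreal l * ennreal p * ennreal p = ennreal (p\<^sup>2 * l)" if "0 \<le> l" "0 \<le> p" for l p :: real
      using that by (simp add: power2_eq_square mult_ac flip: ennreal_mult)
    then show ?thesis using assms by simp
  qed
  finally show ?thesis
    unfolding add.commute[of _ ?c] by (auto simp: ennreal_add_left_cancel ennreal_mult_eq_top_iff)
qed

section \<open>Powers of the tangent, the double sum and the L-value\<close>

lemma borel_measurable_tan [measurable (raw)]: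
  fixes f :: "'a \<Rightarrow> real"
  assumes [measurable]: "f \<in> borel_measurable M"
  shows "(\<lambda>x. tan (f x)) \<in> borel_measurable M"
  unfolding tan_def by measurable

lemma tan_on_open_0_pi4:
  assumes "0 < x" "x < pi / 4"
  shows "0 < tan x" "tan x < 1" "0 < cos x"
  using assms tan_gt_zero[of x] tan_monotone[of x "pi / 4"]
  by (auto simp: tan_45 intro!: cos_gt_zero)

lemma tan_on_closed_0_pi4:
  assumes "0 \<le> x" "x \<le> pi / 4"
  shows "0 \<le> tan x" "tan x \<le> 1" "0 < cos x"
proof -
  have "- (pi / 2) < x" "x < pi / 2"
    using assms pi_gt_zero by linarith+
  then show "0 \<le> tan x" "tan x \<le> 1" "0 < cos x"
    using assms tan_pos_pi2_le[of x] tan_mono_le[of x "pi / 4"] cos_gt_zero_pi[of x]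
    by (auto simp: tan_45)
qed

lemma continuous_on_tan_0_pi4: "continuous_on {0..pi / 4} (tan :: real \<Rightarrow> real)"
proof -
  have "cos x \<noteq> 0" if "x \<in> {0..pi / 4}" for x
    using tan_on_closed_0_pi4(3)[of x] that by auto
  then show ?thesis
    by (intro continuous_intros) auto
qed

lemma has_real_derivative_tan:
  assumes "cos x \<noteq> 0"
  shows "(tan has_real_derivative 1 + (tan x)\<^sup>2) (at x)"
proof -
  have "1 + (tan x)\<^sup>2 = inverse ((cos x)\<^sup>2)"
    using assms tan_sec[of x] by (simp add: power_inverse)
  then show ?thesis using DERIV_tan[OF assms] by simp
qed

text \<open>
  With \<open>t = tan x\<close> this is the integral of \<open>t\<^sup>2\<^sup>n\<^sup>+\<^sup>1 / (1 + t\<^sup>2)\<close> over \<open>[0, 1]\<close>. The angle is kept as variable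
  because it is the one in which the outer integral arises.
\<close>

definition tan_power_integral :: "nat \<Rightarrow> real" where
  "tan_power_integral n = integral {0..pi / 4} (\<lambda>x. tan x ^ (2 * n + 1))"

lemma has_integral_tan_power:
  "((\<lambda>x. tan x ^ (2 * n + 1)) has_integral tan_power_integral n) {0..pi / 4}"
proof -
  have "continuous_on {0..pi / 4} (\<lambda>x. tan x ^ (2 * n + 1))"
    by (intro continuous_intros continuous_on_tan_0_pi4)
  then show ?thesis
    unfolding tan_power_integral_def by (intro integrable_integral integrable_continuous_real)
qed

lemma nn_integral_tan_power:
  "(\<integral>\<^sup>+x. ennreal (tan x ^ (2 * n + 1)) \<partial>lborel_on 0 (pi / 4)) = ennreal (tan_power_integral n)"
  by (rule nn_integral_lborel_on_has_integral[OF _ has_integral_tan_power])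
     (use tan_on_open_0_pi4(1) in \<open>auto intro!: mult_nonneg_nonneg zero_le_power intro: less_imp_le\<close>)

lemma tan_power_integral_nonneg: "0 \<le> tan_power_integral n"
  by (rule has_integral_nonneg[OF has_integral_tan_power])
     (use tan_on_closed_0_pi4(1) in \<open>auto intro!: mult_nonneg_nonneg zero_le_power\<close>)

text \<open>
  The sum of the two integrands is \<open>tan\<^sup>2\<^sup>n\<^sup>+\<^sup>1 \<cdot> tan'\<close>.
\<close>

lemma tan_power_integral_rec:
  "tan_power_integral n + tan_power_integral (Suc n) = 1 / (2 * real (Suc n))"
proof -
  let ?F = "\<lambda>x::real. tan x ^ (2 * n + 2) / (2 * real (Suc n))"
  have "((\<lambda>x. tan x ^ (2 * n + 1) + tan x ^ (2 * Suc n + 1)) has_integral ?F (pi / 4) - ?F 0) {0..pi / 4}"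
  proof (rule fundamental_theorem_of_calculus)
    fix x :: real assume "x \<in> {0..pi / 4}"
    then have "cos x \<noteq> 0"
      using tan_on_closed_0_pi4(3)[of x] by auto
    then have "(?F has_real_derivative real (2 * n + 2) * ((1 + (tan x)\<^sup>2) * tan x ^ (2 * n + 2 - Suc 0)) / (2 * real (Suc n))) (at x)"
      by (intro DERIV_cdivide DERIV_power has_real_derivative_tan)
    also have "real (2 * n + 2) * ((1 + (tan x)\<^sup>2) * tan x ^ (2 * n + 2 - Suc 0)) / (2 * real (Suc n)) =
        tan x ^ (2 * n + 1) + tan x ^ (2 * Suc n + 1)"
      by (simp add: field_simps power2_eq_square)
    finally show "(?F has_vector_derivative tan x ^ (2 * n + 1) + tan x ^ (2 * Suc n + 1)) (at x within {0..pi / 4})"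
      by (simp add: has_real_derivative_iff_has_vector_derivative has_vector_derivative_at_within)
  qed auto
  moreover have "((\<lambda>x. tan x ^ (2 * n + 1) + tan x ^ (2 * Suc n + 1)) has_integral
      tan_power_integral n + tan_power_integral (Suc n)) {0..pi / 4}"
    by (intro has_integral_add has_integral_tan_power)
  ultimately have "tan_power_integral n + tan_power_integral (Suc n) = ?F (pi / 4) - ?F 0"
    by (rule has_integral_unique[rotated])
  then show ?thesis by (simp add: tan_45)
qed

lemma two_tan_power_integral_rec:
  "2 * tan_power_integral n + 2 * tan_power_integral (Suc n) = 1 / real (Suc n)"
  unfolding distrib_left[symmetric] tan_power_integral_rec by (simp del: of_nat_Suc)

lemma alternating_sum_telescope:
  fixes b :: "nat \<Rightarrow> real"
  assumes rec: "\<And>n. b n + b (Suc n) = u (Suc n)" and "j \<le> N"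
  shows "(\<Sum>k\<in>{j<..N}. (-1) ^ (j + k + 1) * u k) = b j - (-1) ^ (j + N) * b N"
  using \<open>j \<le> N\<close>
proof (induction N rule: dec_induct)
  case base
  show ?case by (simp flip: mult_2)
next
  case (step N)
  have "{j<..Suc N} = insert (Suc N) {j<..N}"
    using step.hyps by auto
  then have "(\<Sum>k\<in>{j<..Suc N}. (-1) ^ (j + k + 1) * u k) =
      (-1) ^ (j + N) * u (Suc N) + (b j - (-1) ^ (j + N) * b N)"
    using step.IH by simp
  then show ?case
    by (simp add: algebra_simps flip: rec)
qed

text \<open>
  The inner sums over \<open>k\<close> telescope to \<open>b j\<close> up to a boundary term \<open>\<plusminus> b N\<close>. As \<open>b N\<close> tends
  to \<open>0\<close> and the weights \<open>1 / (2 j + 1)\<^sup>3\<close> are summable, the boundary terms vanish in the limit although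
  the double series does not converge absolutely.
\<close>

lemma double_sum_limit:
  fixes b :: "nat \<Rightarrow> real"
  assumes rec: "\<And>n. b n + b (Suc n) = 1 / real (Suc n)" and nonneg: "\<And>n. 0 \<le> b n"
  shows "summable (\<lambda>j. b j / (2 * real j + 1) ^ 3)"
    and "(\<lambda>N :: nat. \<Sum>(j, k)\<in>{(j, k). 0 \<le> j \<and> j < k \<and> k \<le> N}.
          (-1) ^ (j + k + 1) / ((2 * real j + 1) ^ 3 * real k)) \<longlonglongrightarrow> suminf (\<lambda>j. b j / (2 * real j + 1) ^ 3)"
proof -
  let ?w = "\<lambda>j::nat. 1 / (2 * real j + 1) ^ 3"
  have le: "b n \<le> 1 / real (Suc n)" for n
    using rec[of n] nonneg[of "Suc n"] by simp
  have b0: "b \<longlonglongrightarrow> 0"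
    by (rule tendsto_sandwich[OF _ _ tendsto_const LIMSEQ_Suc[OF lim_inverse_n']])
       (use le nonneg in auto)
  have w: "summable ?w"
  proof (rule summable_comparison_test'[of "\<lambda>j. 1 / real (Suc j) ^ 2" 0])
    show "summable (\<lambda>j. 1 / real (Suc j) ^ 2)"
      using inverse_power_summable[of 2, where 'a = real, OF order_refl]
      by (subst (asm) summable_Suc_iff[symmetric]) (simp add: inverse_eq_divide)
    fix j :: nat
    have "real (Suc j) ^ 2 \<le> (2 * real j + 1) ^ 2"
      by (intro power_mono) auto
    also have "\<dots> \<le> (2 * real j + 1) ^ 3"
      by (intro power_increasing) auto
    finally show "norm (?w j) \<le> 1 / real (Suc j) ^ 2"
      by (simp add: frac_le)
  qed
  have "norm (b j / (2 * real j + 1) ^ 3) \<le> ?w j" for j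
  proof -
    have "b j \<le> 1" using le[of j] by (rule order_trans) simp
    then show ?thesis using nonneg[of j] by (simp add: divide_right_mono)
  qed
  then show summ: "summable (\<lambda>j. b j / (2 * real j + 1) ^ 3)"
    by (intro summable_comparison_test'[OF w, of 0])
  have eq: "(\<Sum>(j, k)\<in>{(j, k). 0 \<le> j \<and> j < k \<and> k \<le> N}. (-1) ^ (j + k + 1) / ((2 * real j + 1) ^ 3 * real k)) =
      (\<Sum>j<Suc N. b j / (2 * real j + 1) ^ 3) - b N * (\<Sum>j<Suc N. (-1) ^ (j + N) * ?w j)" for N
  proof -
    have "{(j, k). 0 \<le> j \<and> j < k \<and> k \<le> N} = Sigma {..<Suc N} (\<lambda>j. {j<..N})"
      by auto
    then have "(\<Sum>(j, k)\<in>{(j, k). 0 \<le> j \<and> j < k \<and> k \<le> N}. (-1) ^ (j + k + 1) / ((2 * real j + 1) ^ 3 * real k)) =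
       (\<Sum>j<Suc N. \<Sum>k\<in>{j<..N}. (-1) ^ (j + k + 1) / ((2 * real j + 1) ^ 3 * real k))"
      by (simp add: sum.Sigma del: sum.lessThan_Suc)
    also have "\<dots> = (\<Sum>j<Suc N. (b j - (-1) ^ (j + N) * b N) * ?w j)"
    proof (rule sum.cong[OF refl])
      fix j assume "j \<in> {..<Suc N}"
      then have tele: "(\<Sum>k\<in>{j<..N}. (-1) ^ (j + k + 1) * (1 / real k)) = b j - (-1) ^ (j + N) * b N"
        by (intro alternating_sum_telescope rec) auto
      show "(\<Sum>k\<in>{j<..N}. (-1) ^ (j + k + 1) / ((2 * real j + 1) ^ 3 * real k)) = (b j - (-1) ^ (j + N) * b N) * ?w j"
        unfolding tele[symmetric] sum_distrib_right by (intro sum.cong refl) simp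
    qed
    finally show ?thesis
      by (simp add: left_diff_distrib diff_divide_distrib sum_subtractf sum_distrib_left mult_ac del: sum.lessThan_Suc)
  qed
  have "(\<lambda>N. b N * (\<Sum>j<Suc N. (-1) ^ (j + N) * ?w j)) \<longlonglongrightarrow> 0"
  proof (rule Lim_null_comparison)
    show "\<forall>\<^sub>F N in sequentially. norm (b N * (\<Sum>j<Suc N. (-1) ^ (j + N) * ?w j)) \<le> b N * suminf ?w"
    proof (intro always_eventually allI)
      fix N
      have "\<bar>\<Sum>j<Suc N. (-1) ^ (j + N) * ?w j\<bar> \<le> (\<Sum>j<Suc N. \<bar>(-1) ^ (j + N) * ?w j\<bar>)"
        by (rule sum_abs)
      also have "\<dots> = (\<Sum>j<Suc N. ?w j)"
        by (intro sum.cong refl) (simp add: abs_mult power_abs)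
      also have "\<dots> \<le> suminf ?w"
        by (intro sum_le_suminf w) auto
      finally show "norm (b N * (\<Sum>j<Suc N. (-1) ^ (j + N) * ?w j)) \<le> b N * suminf ?w"
        using nonneg[of N] by (simp add: abs_mult mult_left_mono del: sum.lessThan_Suc)
    qed
    show "(\<lambda>N. b N * suminf ?w) \<longlonglongrightarrow> 0"
      using tendsto_mult_left_zero[OF b0] by simp
  qed
  moreover have "(\<lambda>N. \<Sum>j<Suc N. b j / (2 * real j + 1) ^ 3) \<longlonglongrightarrow> suminf (\<lambda>j. b j / (2 * real j + 1) ^ 3)"
    using summable_LIMSEQ[OF summ] by (rule LIMSEQ_Suc)
  ultimately show "(\<lambda>N. \<Sum>(j, k)\<in>{(j, k). 0 \<le> j \<and> j < k \<and> k \<le> N}.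
          (-1) ^ (j + k + 1) / ((2 * real j + 1) ^ 3 * real k)) \<longlonglongrightarrow> suminf (\<lambda>j. b j / (2 * real j + 1) ^ 3)"
    unfolding eq by (auto dest: tendsto_diff simp del: sum.lessThan_Suc)
qed

lemma L_series_chi_m4_2:
  assumes "(\<lambda>k. (-1) ^ k / (2 * real k + 1)\<^sup>2) sums c"
  shows "L_series chi_m4 2 = c"
proof -
  let ?f = "\<lambda>n. of_int (chi_m4 (int (Suc n))) * real (Suc n) powr (- 2)"
  have "?f (2 * k) = (-1) ^ k / (2 * real k + 1)\<^sup>2" for k
  proof -
    have "chi_m4 (int (Suc (2 * k))) = (-1) ^ k"
    proof (cases "even k")
      case True
      then obtain i where "k = 2 * i" by (elim evenE)
      then have "int (Suc (2 * k)) mod 4 = 1" by (simp; presburger)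
      with True show ?thesis by (simp add: chi_m4_def)
    next
      case False
      then obtain i where "k = 2 * i + 1" by (elim oddE)
      then have "int (Suc (2 * k)) mod 4 = 3" by (simp; presburger)
      with False show ?thesis by (simp add: chi_m4_def)
    qed
    then show ?thesis
      by (simp add: powr_minus powr_numeral field_simps)
  qed
  then have "(\<lambda>k. ?f (2 * k)) sums c"
    using assms by simp
  moreover have "?f n = 0" if "n \<notin> range (\<lambda>k. 2 * k)" for n
  proof -
    have "odd n" using that by (auto elim: evenE)
    then have "int (Suc n) mod 4 \<noteq> 1" "int (Suc n) mod 4 \<noteq> 3" by (simp; presburger)+
    then show ?thesis by (simp add: chi_m4_def)
  qed
  moreover have "strict_mono (\<lambda>k::nat. 2 * k)"
    by (simp add: strict_mono_def)
  ultimately have "?f sums c"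
    using sums_mono_reindex[of "\<lambda>k. 2 * k" ?f c] by blast
  then show ?thesis
    unfolding L_series_def by (rule sums_unique[symmetric])
qed

text \<open>
  With \<open>t = tan x\<close> this is the integral of \<open>- ln t / (1 + t\<^sup>2)\<close> over \<open>[0, 1]\<close>, Catalan's constant.
  Inserting the factors \<open>tan x\<close> to the power \<open>2 n\<close> gives integrals \<open>D n\<close> for which \<open>D n + D (n + 1)\<close> is
  elementary, so that the alternating series of these values telescopes to \<open>D 0\<close>.
\<close>

lemma nn_integral_ln_tan:
  "(\<integral>\<^sup>+x. ennreal (- ln (tan x)) \<partial>lborel_on 0 (pi / 4)) = ennreal (L_series chi_m4 2)"
  "0 \<le> L_series chi_m4 2"
proof -
  define D where "D = (\<lambda>n. \<integral>\<^sup>+x. ennreal (tan x ^ (2 * n) * - ln (tan x)) \<partial>lborel_on 0 (pi / 4))"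
  have rec: "D n + D (Suc n) = ennreal (1 / (2 * real n + 1)\<^sup>2)" for n
  proof -
    define m where "m = real (2 * n + 1)"
    have m: "m > 0" "m = 2 * real n + 1" by (auto simp: m_def)
    let ?G = "\<lambda>t::real. t ^ (2 * n + 1) / m\<^sup>2 - t ^ (2 * n) * (t * ln t) / m"
    let ?g = "\<lambda>x::real. (tan x ^ (2 * n) + tan x ^ (2 * Suc n)) * - ln (tan x)"
    have "D n + D (Suc n) = (\<integral>\<^sup>+x. ennreal (tan x ^ (2 * n) * - ln (tan x)) +
         ennreal (tan x ^ (2 * Suc n) * - ln (tan x)) \<partial>lborel_on 0 (pi / 4))"
      unfolding D_def by (subst nn_integral_add) auto
    also have "\<dots> = (\<integral>\<^sup>+x. ennreal (?g x) \<partial>lborel_on 0 (pi / 4))"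
    proof (rule nn_integral_lborel_on_cong)
      fix x :: real assume "0 < x" "x < pi / 4"
      then have t: "0 < tan x" "0 \<le> - ln (tan x)"
        using tan_on_open_0_pi4[of x] by auto
      have "0 \<le> tan x ^ k * - ln (tan x)" for k
        using t by (intro mult_nonneg_nonneg zero_le_power) auto
      then show "ennreal (tan x ^ (2 * n) * - ln (tan x)) + ennreal (tan x ^ (2 * Suc n) * - ln (tan x)) = ennreal (?g x)"
        by (simp only: distrib_right flip: ennreal_plus)
    qed
    also have "\<dots> = ennreal (?G (tan (pi / 4)) - ?G (tan 0))"
    proof (rule nn_integral_lborel_on_FTC)
      have "continuous_on {0..1} ?G"
        using m by (intro continuous_intros continuous_on_mult_ln) auto
      moreover have "continuous_on {0..pi / 4} (tan :: real \<Rightarrow> real)"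
        by (rule continuous_on_tan_0_pi4)
      moreover have "tan ` {0..pi / 4} \<subseteq> {0..1::real}"
        using tan_on_closed_0_pi4 by auto
      ultimately show "continuous_on {0..pi / 4} (\<lambda>x. ?G (tan x))"
        by (rule continuous_on_compose2)
    next
      fix x :: real assume x: "0 < x" "x < pi / 4"
      define t where "t = tan x"
      have t: "0 < t" "t < 1" "cos x \<noteq> 0"
        using tan_on_open_0_pi4[OF x] by (auto simp: t_def)
      show "0 \<le> ?g x"
        using t by (intro mult_nonneg_nonneg add_nonneg_nonneg zero_le_power) (auto simp: t_def)
      have "((\<lambda>t. t ^ (2 * n + 1) / m\<^sup>2 - t ^ (2 * n + 1) * ln t / m) has_real_derivative
          (m * t ^ (2 * n) / m\<^sup>2 - (m * t ^ (2 * n) * ln t + 1 / t * t ^ (2 * n + 1)) / m)) (at t)"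
      proof -
        have "((\<lambda>t. t ^ (2 * n + 1)) has_real_derivative (m * t ^ (2 * n))) (at t)"
          using DERIV_pow[of "2 * n + 1" t UNIV] by (simp add: m_def)
        then show ?thesis
          using t by (intro DERIV_diff DERIV_cdivide DERIV_mult DERIV_ln_divide)
      qed
      also have "(m * t ^ (2 * n) / m\<^sup>2 - (m * t ^ (2 * n) * ln t + 1 / t * t ^ (2 * n + 1)) / m) = - (t ^ (2 * n) * ln t)"
        using t m(1) by (simp add: field_simps power2_eq_square)
      also have "(\<lambda>t. t ^ (2 * n + 1) / m\<^sup>2 - t ^ (2 * n + 1) * ln t / m) = ?G"
        by (simp add: mult_ac)
      finally have "((\<lambda>x. ?G (tan x)) has_real_derivative - (t ^ (2 * n) * ln t) * (1 + (tan x)\<^sup>2)) (at x)"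
        unfolding t_def using has_real_derivative_tan[OF t(3)] by (rule DERIV_chain2)
      also have "- (t ^ (2 * n) * ln t) * (1 + (tan x)\<^sup>2) = ?g x"
        by (simp add: t_def algebra_simps power2_eq_square)
      finally show "((\<lambda>x. ?G (tan x)) has_real_derivative ?g x) (at x)" .
    qed auto
    also have "?G (tan (pi / 4)) - ?G (tan 0) = 1 / (2 * real n + 1)\<^sup>2"
      by (simp add: tan_45 m(2))
    finally show ?thesis .
  qed
  define d where "d = (\<lambda>n. enn2real (D n))"
  have fin: "D n < top" for n
    using rec[of n] by (metis ennreal_add_eq_top ennreal_neq_top less_top)
  have D: "D n = ennreal (d n)" for n
    using fin[of n] by (simp add: d_def)
  have dn: "0 \<le> d n" for n by (simp add: d_def)
  have rec': "d n + d (Suc n) = 1 / (2 * real n + 1)\<^sup>2" for n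
    using rec[of n] dn by (simp add: D flip: ennreal_plus)
  have d0: "d \<longlonglongrightarrow> 0"
  proof (rule tendsto_sandwich[OF _ _ tendsto_const])
    show "(\<lambda>n. 1 / (2 * real n + 1)\<^sup>2) \<longlonglongrightarrow> 0" by real_asymp
    show "\<forall>\<^sub>F n in sequentially. d n \<le> 1 / (2 * real n + 1)\<^sup>2"
      using rec' dn by (intro always_eventually allI) (metis add_increasing2 add.commute le_add_same_cancel1)
  qed (use dn in auto)
  have partial: "(\<Sum>k<n. (-1) ^ k / (2 * real k + 1)\<^sup>2) = d 0 - (-1) ^ n * d n" for n
  proof (induction n)
    case (Suc n)
    have "(-1) ^ n / (2 * real n + 1)\<^sup>2 = (-1) ^ n * (d n + d (Suc n))"
      by (simp add: rec')
    then show ?case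
      unfolding sum.lessThan_Suc Suc by (simp add: algebra_simps)
  qed simp
  have "(\<lambda>n. (-1) ^ n * d n) \<longlonglongrightarrow> 0"
    by (rule Lim_null_comparison[OF _ d0]) (use dn in \<open>auto simp: abs_mult power_abs\<close>)
  then have "(\<lambda>n. d 0 - (-1) ^ n * d n) \<longlonglongrightarrow> d 0 - 0"
    by (intro tendsto_diff tendsto_const)
  then have "(\<lambda>k. (-1) ^ k / (2 * real k + 1)\<^sup>2) sums d 0"
    by (simp add: sums_def partial)
  then have "L_series chi_m4 2 = d 0"
    by (rule L_series_chi_m4_2)
  then show "(\<integral>\<^sup>+x. ennreal (- ln (tan x)) \<partial>lborel_on 0 (pi / 4)) = ennreal (L_series chi_m4 2)"
    "0 \<le> L_series chi_m4 2"
    using D[of 0] dn[of 0] by (simp_all add: D_def)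
qed

text \<open>
  Reflection at \<open>\<pi>/4\<close> and the inversion formula reduce everything to arguments \<open>tan x < 1\<close>, where
  the series applies. The inversion term gives the L-value, the series the double sum.
\<close>

lemma nn_integral_cos_ratio_integral_cot:
  "(\<integral>\<^sup>+x. cos_ratio_integral (cos x / sin x) \<partial>lborel_on 0 (pi / 2)) =
     ennreal ((pi / 2)\<^sup>2 * L_series chi_m4 2 + suminf (\<lambda>j. 2 * tan_power_integral j / (2 * real j + 1) ^ 3))"
proof -
  have [measurable]: "cos_ratio_integral \<in> borel_measurable borel"
    unfolding cos_ratio_integral_def[abs_def] by measurable
  have summ: "summable (\<lambda>j. 2 * tan_power_integral j / (2 * real j + 1) ^ 3)"
    using tan_power_integral_nonneg by (intro double_sum_limit two_tan_power_integral_rec) simp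
  have "(\<integral>\<^sup>+x. cos_ratio_integral (cos x / sin x) \<partial>lborel_on 0 (pi / 2)) =
     (\<integral>\<^sup>+x. cos_ratio_integral (cos x / sin x) \<partial>lborel_on 0 (pi / 4)) +
     (\<integral>\<^sup>+x. cos_ratio_integral (cos x / sin x) \<partial>lborel_on (pi / 4) (pi / 2))"
    by (rule nn_integral_lborel_on_split) auto
  also have "(\<integral>\<^sup>+x. cos_ratio_integral (cos x / sin x) \<partial>lborel_on (pi / 4) (pi / 2)) =
      (\<integral>\<^sup>+x. cos_ratio_integral (tan x) \<partial>lborel_on 0 (pi / 4))"
    using nn_integral_lborel_on_reflect[of "\<lambda>x. cos_ratio_integral (cos x / sin x)" "pi / 2" "pi / 4" 0]
    by (simp add: cos_diff sin_diff tan_def)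
  also have "(\<integral>\<^sup>+x. cos_ratio_integral (cos x / sin x) \<partial>lborel_on 0 (pi / 4)) =
     (\<integral>\<^sup>+x. ennreal ((pi / 2)\<^sup>2) * ennreal (- ln (tan x)) + cos_ratio_integral (tan x) \<partial>lborel_on 0 (pi / 4))"
  proof (rule nn_integral_lborel_on_cong)
    fix x :: real assume "0 < x" "x < pi / 4"
    note t = tan_on_open_0_pi4[OF this]
    have "cos x / sin x = 1 / tan x" by (simp add: tan_def)
    then show "cos_ratio_integral (cos x / sin x) = ennreal ((pi / 2)\<^sup>2) * ennreal (- ln (tan x)) + cos_ratio_integral (tan x)"
      using cos_ratio_integral_inverse[OF t(1,2)] t ennreal_mult[of "(pi / 2)\<^sup>2" "- ln (tan x)"]
      by (simp only: zero_le_power2) simp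
  qed
  also have "\<dots> = ennreal ((pi / 2)\<^sup>2) * ennreal (L_series chi_m4 2) + (\<integral>\<^sup>+x. cos_ratio_integral (tan x) \<partial>lborel_on 0 (pi / 4))"
    by (subst nn_integral_add) (auto simp: nn_integral_cmult nn_integral_ln_tan(1))
  finally have "(\<integral>\<^sup>+x. cos_ratio_integral (cos x / sin x) \<partial>lborel_on 0 (pi / 2)) =
      ennreal ((pi / 2)\<^sup>2) * ennreal (L_series chi_m4 2) + 2 * (\<integral>\<^sup>+x. cos_ratio_integral (tan x) \<partial>lborel_on 0 (pi / 4))"
    by (simp add: mult_2 add.assoc)
  also have "(\<integral>\<^sup>+x. cos_ratio_integral (tan x) \<partial>lborel_on 0 (pi / 4)) =
     (\<integral>\<^sup>+x. suminf (\<lambda>n. ennreal (1 / real (2 * n + 1) ^ 3) * ennreal (tan x ^ (2 * n + 1))) \<partial>lborel_on 0 (pi / 4))"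
  proof (rule nn_integral_lborel_on_cong)
    fix x :: real assume "0 < x" "x < pi / 4"
    note t = tan_on_open_0_pi4[OF this]
    have "ennreal (tan x ^ (2 * n + 1) / real (2 * n + 1) ^ 3) =
        ennreal (1 / real (2 * n + 1) ^ 3) * ennreal (tan x ^ (2 * n + 1))" for n
      using t by (subst ennreal_mult[symmetric]) (auto simp del: power_Suc)
    then show "cos_ratio_integral (tan x) = suminf (\<lambda>n. ennreal (1 / real (2 * n + 1) ^ 3) * ennreal (tan x ^ (2 * n + 1)))"
      unfolding cos_ratio_integral_series[OF t(1,2)] by simp
  qed
  also have "\<dots> = suminf (\<lambda>n. ennreal (1 / real (2 * n + 1) ^ 3) * ennreal (tan_power_integral n))"
  proof (subst nn_integral_suminf)
    have "(\<integral>\<^sup>+x. ennreal (1 / real (2 * n + 1) ^ 3) * ennreal (tan x ^ (2 * n + 1)) \<partial>lborel_on 0 (pi / 4)) =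
        ennreal (1 / real (2 * n + 1) ^ 3) * ennreal (tan_power_integral n)" for n
      by (subst nn_integral_cmult, measurable) (simp only: nn_integral_tan_power)
    then show "suminf (\<lambda>n. \<integral>\<^sup>+x. ennreal (1 / real (2 * n + 1) ^ 3) * ennreal (tan x ^ (2 * n + 1)) \<partial>lborel_on 0 (pi / 4)) =
        suminf (\<lambda>n. ennreal (1 / real (2 * n + 1) ^ 3) * ennreal (tan_power_integral n))"
      by (simp only:)
  qed measurable
  also have "2 * \<dots> = suminf (\<lambda>j. ennreal (2 * tan_power_integral j / (2 * real j + 1) ^ 3))"
    unfolding ennreal_suminf_cmult[symmetric]
    using tan_power_integral_nonneg by (intro suminf_cong) (simp add: add.commute flip: ennreal_mult ennreal_numeral)
  also have "\<dots> = ennreal (suminf (\<lambda>j. 2 * tan_power_integral j / (2 * real j + 1) ^ 3))"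
    using tan_power_integral_nonneg by (intro suminf_ennreal2 summ) auto
  finally show ?thesis
    using nn_integral_ln_tan(2) summ tan_power_integral_nonneg
    by (simp add: ennreal_mult ennreal_plus suminf_nonneg)
qed

section \<open>Reduction of the Mahler measure\<close>

lemma nn_integral_indicator_Icc:
  assumes [measurable]: "f \<in> borel_measurable borel"
  shows "(\<integral>\<^sup>+x. indicator {a..b} x * f x \<partial>lborel) = (\<integral>\<^sup>+x. f x \<partial>lborel_on a b)"
  unfolding nn_integral_lborel_on[OF assms]
  by (rule nn_integral_cong_AE, rule AE_mp[OF AE_lborel_singleton[of a]],
      rule AE_mp[OF AE_lborel_singleton[of b]]) (auto simp: indicator_def)

text \<open>
  The values of the polynomial on the torus, in angular coordinates for \<open>w, x, y, z\<close>.
\<close>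

definition torus_value :: "real \<Rightarrow> real \<Rightarrow> real \<Rightarrow> real \<Rightarrow> complex" where
  "torus_value a b c d = (1 + cis a) * (1 + cis b) + (1 - cis a) * (cis c + cis d)"

lemma borel_measurable_torus_value [measurable (raw)]:
  assumes [measurable]: "f \<in> borel_measurable M" "g \<in> borel_measurable M"
    "h \<in> borel_measurable M" "k \<in> borel_measurable M"
  shows "(\<lambda>x. torus_value (f x) (g x) (h x) (k x)) \<in> borel_measurable M"
  unfolding torus_value_def by measurable

lemma norm_torus_value_le: "cmod (torus_value a b c d) \<le> 8"
proof -
  have 1: "cmod (u + v) \<le> 2" if "cmod u = 1" "cmod v = 1" for u v
    using norm_triangle_ineq[of u v] that by simp
  have 2: "cmod (1 - cis a) \<le> 2"
    using 1[of 1 "- cis a"] by simp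
  have "cmod (torus_value a b c d) \<le>
      cmod (1 + cis a) * cmod (1 + cis b) + cmod (1 - cis a) * cmod (cis c + cis d)"
    unfolding torus_value_def using norm_triangle_ineq by (simp only: norm_mult[symmetric])
  also have "\<dots> \<le> 2 * 2 + 2 * 2"
    by (intro add_mono mult_mono 1 2) auto
  finally show ?thesis by simp
qed

lemma ln_norm_torus_value_le: "ln (cmod (torus_value a b c d)) \<le> ln 8"
  using norm_torus_value_le[of a b c d]
  by (cases "torus_value a b c d = 0") (auto intro!: ln_mono)

text \<open>
  Tonelli's theorem on the torus. It is stated for a nonnegative \<open>u\<close>, since integrability of the
  logarithm is only known afterwards.
\<close>

lemma nn_integral_torus:
  fixes u :: "complex \<Rightarrow> ennreal"
  assumes [measurable]: "u \<in> borel_measurable borel"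
  shows "(\<integral>\<^sup>+t. indicator (\<Pi>\<^sub>E k\<in>{..<4}. {0..2 * pi}) t * u (torus_value (t 0) (t 1) (t 2) (t 3)) \<partial>(\<Pi>\<^sub>M k\<in>{..<4::nat}. lborel)) =
    (\<integral>\<^sup>+a. \<integral>\<^sup>+b. \<integral>\<^sup>+c. \<integral>\<^sup>+d. u (torus_value a b c d)
      \<partial>lborel_on 0 (2 * pi) \<partial>lborel_on 0 (2 * pi) \<partial>lborel_on 0 (2 * pi) \<partial>lborel_on 0 (2 * pi))"
proof -
  interpret product_sigma_finite "\<lambda>k::nat. lborel :: real measure" ..
  define I :: "real \<Rightarrow> ennreal" where "I = indicator {0..2 * pi}"
  have [measurable]: "I \<in> borel_measurable borel" by (simp add: I_def)
  have set: "{..<4::nat} = insert 3 (insert 2 (insert 1 {0}))" by auto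
  have "(\<integral>\<^sup>+t. indicator (\<Pi>\<^sub>E k\<in>{..<4}. {0..2 * pi}) t * u (torus_value (t 0) (t 1) (t 2) (t 3)) \<partial>(\<Pi>\<^sub>M k\<in>{..<4::nat}. lborel)) =
    (\<integral>\<^sup>+t. I (t 0) * (I (t 1) * (I (t 2) * (I (t 3) * u (torus_value (t 0) (t 1) (t 2) (t 3))))) \<partial>(\<Pi>\<^sub>M k\<in>{..<4::nat}. lborel))"
  proof (rule nn_integral_cong)
    fix t :: "nat \<Rightarrow> real" assume "t \<in> space (\<Pi>\<^sub>M k\<in>{..<4::nat}. lborel)"
    then have "t \<in> extensional {..<4}" by (simp add: space_PiM PiE_def)
    then have "t \<in> (\<Pi>\<^sub>E k\<in>{..<4}. {0..2 * pi}) \<longleftrightarrow>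
      t 0 \<in> {0..2 * pi} \<and> t 1 \<in> {0..2 * pi} \<and> t 2 \<in> {0..2 * pi} \<and> t 3 \<in> {0..2 * pi}"
      unfolding PiE_def set by auto
    then have "indicator (\<Pi>\<^sub>E k\<in>{..<4}. {0..2 * pi}) t = I (t 0) * (I (t 1) * (I (t 2) * I (t 3)))"
      unfolding I_def by (auto simp: indicator_def)
    then show "indicator (\<Pi>\<^sub>E k\<in>{..<4}. {0..2 * pi}) t * u (torus_value (t 0) (t 1) (t 2) (t 3)) =
        I (t 0) * (I (t 1) * (I (t 2) * (I (t 3) * u (torus_value (t 0) (t 1) (t 2) (t 3)))))"
      by (simp only: mult.assoc)
  qed
  also have "\<dots> = (\<integral>\<^sup>+a. \<integral>\<^sup>+b. \<integral>\<^sup>+c. \<integral>\<^sup>+d. I a * (I b * (I c * (I d * u (torus_value a b c d)))) \<partial>lborel \<partial>lborel \<partial>lborel \<partial>lborel)"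
    unfolding set
    by (simp add: product_nn_integral_insert emeasure_PiM_empty space_PiM)
  also have "\<dots> = (\<integral>\<^sup>+a. I a * (\<integral>\<^sup>+b. I b * (\<integral>\<^sup>+c. I c * (\<integral>\<^sup>+d. I d * u (torus_value a b c d) \<partial>lborel) \<partial>lborel) \<partial>lborel) \<partial>lborel)"
    by (simp add: nn_integral_cmult)
  also have "\<dots> = (\<integral>\<^sup>+a. \<integral>\<^sup>+b. \<integral>\<^sup>+c. \<integral>\<^sup>+d. u (torus_value a b c d)
      \<partial>lborel_on 0 (2 * pi) \<partial>lborel_on 0 (2 * pi) \<partial>lborel_on 0 (2 * pi) \<partial>lborel_on 0 (2 * pi))"
    unfolding I_def by (simp add: nn_integral_indicator_Icc)
  finally show ?thesis .
qed

lemma norm_one_plus_cis: "cmod (1 + cis t) = 2 * \<bar>cos (t / 2)\<bar>"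
proof -
  have "1 + cis t = cis (t / 2) * of_real (2 * cos (t / 2))"
    using cos_double_cos[of "t / 2"] sin_double[of "t / 2"]
    by (simp add: complex_eq_iff power2_eq_square algebra_simps)
  then show ?thesis by (simp add: norm_mult)
qed

lemma norm_one_minus_cis: "cmod (1 - cis t) = 2 * \<bar>sin (t / 2)\<bar>"
proof -
  have "1 - cis t = cis (t / 2) * of_real (2 * sin (t / 2)) * (- \<i>)"
    using cos_double_sin[of "t / 2"] sin_double[of "t / 2"]
    by (simp add: complex_eq_iff power2_eq_square algebra_simps)
  then show ?thesis by (simp add: norm_mult)
qed

text \<open>
  On a period the modulus \<open>\<bar>1 + cis t\<bar> = 2 \<bar>cos (t/2)\<bar>\<close> takes every value at most twice. This disposes of
  the exceptional case in Jensen's formula.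
\<close>

lemma AE_norm_one_plus_cis_neq: "AE t in lborel_on 0 (2 * pi). cmod (1 + cis t) \<noteq> r"
proof -
  have "cmod (1 + cis t) \<noteq> r"
    if "0 < t \<and> t < 2 * pi" "t \<noteq> 2 * arccos (r / 2)" "t \<noteq> 2 * arccos (- r / 2)" for t
  proof
    assume "cmod (1 + cis t) = r"
    then have "cos (t / 2) = r / 2 \<or> cos (t / 2) = - r / 2"
      unfolding norm_one_plus_cis by auto
    moreover have "arccos (cos (t / 2)) = t / 2"
      using that by (intro arccos_cos) auto
    ultimately show False using that by auto
  qed
  note neq = this
  show ?thesis
    using AE_lborel_on[of 0 "2 * pi"] AE_lborel_on_neq[where c = "2 * arccos (r / 2)"]
      AE_lborel_on_neq[where c = "2 * arccos (- r / 2)"]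
  proof eventually_elim
    case (elim t)
    then show ?case by (rule neq)
  qed
qed

text \<open>
  Multiplying the second variable by the first one, which preserves the measure of the torus, turns
  \<open>y + z\<close> into \<open>y (1 + z)\<close>. The polynomial becomes linear in \<open>y\<close>, and Jensen's formula removes \<open>y\<close>.
\<close>

lemma nn_integral_ln_norm_bilinear:
  assumes "B \<noteq> 0" and K: "cmod A + 2 * cmod B \<le> exp K"
  shows "(\<integral>\<^sup>+c. \<integral>\<^sup>+d. ennreal (K - ln (cmod (A + B * (cis c + cis d)))) \<partial>lborel_on 0 (2 * pi) \<partial>lborel_on 0 (2 * pi)) =
     (\<integral>\<^sup>+d. ennreal (2 * pi * (K - ln (max (cmod A) (cmod B * cmod (1 + cis d))))) \<partial>lborel_on 0 (2 * pi))"
proof -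
  let ?L = "lborel_on 0 (2 * pi)"
  have "(\<integral>\<^sup>+c. \<integral>\<^sup>+d. ennreal (K - ln (cmod (A + B * (cis c + cis d)))) \<partial>?L \<partial>?L) =
        (\<integral>\<^sup>+c. \<integral>\<^sup>+d. ennreal (K - ln (cmod (A + B * (1 + cis d) * cis c))) \<partial>?L \<partial>?L)"
  proof (rule nn_integral_lborel_on_cong)
    fix c :: real assume c: "0 < c" "c < 2 * pi"
    have "(\<integral>\<^sup>+d. ennreal (K - ln (cmod (A + B * (cis c + cis (c + d))))) \<partial>?L) =
          (\<integral>\<^sup>+d. ennreal (K - ln (cmod (A + B * (cis c + cis d)))) \<partial>?L)"
    proof (rule nn_integral_lborel_on_shift_periodic)
      fix x
      have "cis (x + 2 * pi) = cis x"
        by (simp add: complex_eq_iff)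
      then show "ennreal (K - ln (cmod (A + B * (cis c + cis (x + 2 * pi))))) = ennreal (K - ln (cmod (A + B * (cis c + cis x))))"
        by simp
    qed (use c in auto)
    moreover have "B * (cis c + cis (c + d)) = B * (1 + cis d) * cis c" for d
      by (simp add: algebra_simps flip: cis_mult)
    ultimately show "(\<integral>\<^sup>+d. ennreal (K - ln (cmod (A + B * (cis c + cis d)))) \<partial>?L) =
       (\<integral>\<^sup>+d. ennreal (K - ln (cmod (A + B * (1 + cis d) * cis c))) \<partial>?L)"
      by simp
  qed
  also have "\<dots> = (\<integral>\<^sup>+d. \<integral>\<^sup>+c. ennreal (K - ln (cmod (A + B * (1 + cis d) * cis c))) \<partial>?L \<partial>?L)"
    by (rule nn_integral_lborel_on_swap) measurable
  also have "\<dots> = (\<integral>\<^sup>+d. ennreal (2 * pi * (K - ln (max (cmod A) (cmod B * cmod (1 + cis d))))) \<partial>?L)"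
  proof (rule nn_integral_cong_AE, rule AE_mp[OF AE_norm_one_plus_cis_neq[of "cmod A / cmod B"]], intro AE_I2 impI)
    fix d assume "cmod (1 + cis d) \<noteq> cmod A / cmod B"
    then have "cmod A \<noteq> cmod B * cmod (1 + cis d)"
      using \<open>B \<noteq> 0\<close> by auto
    then have ne: "cmod A \<noteq> cmod (B * (1 + cis d))"
      by (simp only: norm_mult not_False_eq_True)
    have "cmod (B * (1 + cis d)) \<le> cmod B * 2"
      unfolding norm_mult norm_one_plus_cis by (intro mult_left_mono) auto
    then have "cmod A + cmod (B * (1 + cis d)) \<le> exp K"
      using K by simp
    from nn_integral_ln_cmod_linear[OF ne this]
    show "(\<integral>\<^sup>+c. ennreal (K - ln (cmod (A + B * (1 + cis d) * cis c))) \<partial>?L) =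
        ennreal (2 * pi * (K - ln (max (cmod A) (cmod B * cmod (1 + cis d)))))"
      by (simp add: norm_mult)
  qed
  finally show ?thesis .
qed

lemma nn_integral_half_angle:
  assumes [measurable]: "f \<in> borel_measurable borel" and sym: "\<And>x. f (2 * pi - x) = f x"
  shows "(\<integral>\<^sup>+x. f x \<partial>lborel_on 0 (2 * pi)) = 4 * (\<integral>\<^sup>+x. f (2 * x) \<partial>lborel_on 0 (pi / 2))"
proof -
  have "(\<integral>\<^sup>+x. f x \<partial>lborel_on 0 (2 * pi)) = 2 * (\<integral>\<^sup>+x. f x \<partial>lborel_on 0 pi)"
    by (rule nn_integral_lborel_on_symmetric) (use sym in auto)
  also have "(\<integral>\<^sup>+x. f x \<partial>lborel_on 0 pi) = 2 * (\<integral>\<^sup>+x. f (2 * x) \<partial>lborel_on 0 (pi / 2))"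
    using nn_integral_lborel_on_affine[of f 2 0 0 "pi / 2"] by simp
  finally show ?thesis
    by (simp flip: mult.assoc)
qed

text \<open>
  What Jensen's formula leaves of the integrand, at the half angles \<open>a\<close>, \<open>b\<close>, \<open>d\<close> of \<open>w\<close>, \<open>x\<close>, \<open>z\<close>:
  the arguments of \<open>max\<close> are \<open>\<bar>(1 + w) (1 + x)\<bar>\<close> and \<open>\<bar>(1 - w) (1 + z)\<bar>\<close>. The bound \<open>8\<close> of the
  polynomial on the torus makes the integrand nonnegative.
\<close>

definition octant_integrand :: "real \<Rightarrow> real \<Rightarrow> real \<Rightarrow> ennreal" where
  "octant_integrand a b d = ennreal (ln 8 - ln (max (4 * \<bar>cos a * cos b\<bar>) (4 * \<bar>sin a * cos d\<bar>)))"

lemma borel_measurable_octant_integrand [measurable (raw)]: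
  assumes [measurable]: "f \<in> borel_measurable M" "g \<in> borel_measurable M" "k \<in> borel_measurable M"
  shows "(\<lambda>x. octant_integrand (f x) (g x) (k x)) \<in> borel_measurable M"
  unfolding octant_integrand_def by measurable

definition octant_integral :: ennreal where
  "octant_integral = (\<integral>\<^sup>+a. \<integral>\<^sup>+b. \<integral>\<^sup>+d. octant_integrand a b d
      \<partial>lborel_on 0 (pi / 2) \<partial>lborel_on 0 (pi / 2) \<partial>lborel_on 0 (pi / 2))"

lemma nn_integral_torus_value:
  "(\<integral>\<^sup>+a. \<integral>\<^sup>+b. \<integral>\<^sup>+c. \<integral>\<^sup>+d. ennreal (ln 8 - ln (cmod (torus_value a b c d)))
      \<partial>lborel_on 0 (2 * pi) \<partial>lborel_on 0 (2 * pi) \<partial>lborel_on 0 (2 * pi) \<partial>lborel_on 0 (2 * pi)) =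
   ennreal (128 * pi) * octant_integral"
proof -
  let ?L = "lborel_on 0 (2 * pi)" and ?H = "lborel_on 0 (pi / 2)"
  have c: "cos ((2 * pi - x) / 2) = - cos (x / 2)" "sin ((2 * pi - x) / 2) = sin (x / 2)" for x
    by (simp_all add: cos_diff sin_diff diff_divide_distrib)
  have sym:
    "octant_integrand ((2 * pi - x) / 2) = octant_integrand (x / 2)"
    "octant_integrand a ((2 * pi - x) / 2) = octant_integrand a (x / 2)"
    "octant_integrand a b ((2 * pi - x) / 2) = octant_integrand a b (x / 2)" for a b x
    by (simp_all add: octant_integrand_def fun_eq_iff c)
  have "(\<integral>\<^sup>+a. \<integral>\<^sup>+b. \<integral>\<^sup>+c. \<integral>\<^sup>+d. ennreal (ln 8 - ln (cmod (torus_value a b c d))) \<partial>?L \<partial>?L \<partial>?L \<partial>?L) =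
    (\<integral>\<^sup>+a. \<integral>\<^sup>+b. \<integral>\<^sup>+d. ennreal (2 * pi) * octant_integrand (a / 2) (b / 2) (d / 2) \<partial>?L \<partial>?L \<partial>?L)"
  proof (rule nn_integral_lborel_on_cong, rule nn_integral_lborel_on_cong)
    fix a b :: real assume a: "0 < a" "a < 2 * pi"
    have "1 - cis a \<noteq> 0"
    proof -
      have "0 < sin (a / 2)" using a by (intro sin_gt_zero) auto
      then have "0 < cmod (1 - cis a)" by (simp add: norm_one_minus_cis)
      then show ?thesis by simp
    qed
    moreover have "cmod ((1 + cis a) * (1 + cis b)) + 2 * cmod (1 - cis a) \<le> exp (ln 8)"
    proof -
      have "cmod (1 + cis a) * cmod (1 + cis b) \<le> 2 * 2"
        unfolding norm_one_plus_cis by (intro mult_mono) auto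
      moreover have "cmod (1 - cis a) \<le> 2"
        unfolding norm_one_minus_cis by simp
      ultimately show ?thesis by (simp add: norm_mult)
    qed
    ultimately have "(\<integral>\<^sup>+c. \<integral>\<^sup>+d. ennreal (ln 8 - ln (cmod (torus_value a b c d))) \<partial>?L \<partial>?L) =
      (\<integral>\<^sup>+d. ennreal (2 * pi * (ln 8 - ln (max (cmod ((1 + cis a) * (1 + cis b))) (cmod (1 - cis a) * cmod (1 + cis d))))) \<partial>?L)"
      unfolding torus_value_def by (rule nn_integral_ln_norm_bilinear)
    also have "\<dots> = (\<integral>\<^sup>+d. ennreal (2 * pi) * octant_integrand (a / 2) (b / 2) (d / 2) \<partial>?L)"
      unfolding octant_integrand_def norm_mult norm_one_plus_cis norm_one_minus_cis
      by (subst ennreal_mult'[symmetric]) (auto simp: abs_mult mult_ac)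
    finally show "(\<integral>\<^sup>+c. \<integral>\<^sup>+d. ennreal (ln 8 - ln (cmod (torus_value a b c d))) \<partial>?L \<partial>?L) = \<dots>" .
  qed
  also have "\<dots> = ennreal (2 * pi) * (\<integral>\<^sup>+a. \<integral>\<^sup>+b. \<integral>\<^sup>+d. octant_integrand (a / 2) (b / 2) (d / 2) \<partial>?L \<partial>?L \<partial>?L)"
    by (simp add: nn_integral_cmult)
  also have "(\<integral>\<^sup>+a. \<integral>\<^sup>+b. \<integral>\<^sup>+d. octant_integrand (a / 2) (b / 2) (d / 2) \<partial>?L \<partial>?L \<partial>?L) =
      (\<integral>\<^sup>+a. \<integral>\<^sup>+b. 4 * (\<integral>\<^sup>+d. octant_integrand (a / 2) (b / 2) d \<partial>?H) \<partial>?L \<partial>?L)"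
    by (subst nn_integral_half_angle[where f = "\<lambda>d. octant_integrand _ _ (d / 2)"]) (auto simp: sym)
  also have "\<dots> = (\<integral>\<^sup>+a. 4 * (\<integral>\<^sup>+b. 4 * (\<integral>\<^sup>+d. octant_integrand (a / 2) b d \<partial>?H) \<partial>?H) \<partial>?L)"
    by (subst nn_integral_half_angle[where f = "\<lambda>b. 4 * (\<integral>\<^sup>+d. octant_integrand _ (b / 2) d \<partial>?H)"]) (auto simp: sym)
  also have "\<dots> = 4 * (\<integral>\<^sup>+a. 4 * (\<integral>\<^sup>+b. 4 * (\<integral>\<^sup>+d. octant_integrand a b d \<partial>?H) \<partial>?H) \<partial>?H)"
    by (subst nn_integral_half_angle) (auto simp: sym)
  also have "\<dots> = 64 * octant_integral"
    unfolding octant_integral_def by (simp add: nn_integral_cmult)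
  also have "ennreal (2 * pi) * (64 * octant_integral) = ennreal (128 * pi) * octant_integral"
  proof -
    have "ennreal (2 * pi) * 64 = ennreal (2 * pi * 64)"
      by (subst ennreal_mult) auto
    then show ?thesis by (simp add: mult.assoc[symmetric])
  qed
  finally show ?thesis .
qed

text \<open>
  With \<open>u = cos a cos b\<close> and \<open>v = sin a cos d\<close> this is \<open>ln (max u v) = ln v + max 0 (ln (u / v))\<close>, where \<open>ln v\<close>
  splits into logarithms of a single sine or cosine, whose integrals are known.
\<close>

lemma octant_integral_plus_cos_ratio_integral:
  "octant_integral + (\<integral>\<^sup>+a. cos_ratio_integral (cos a / sin a) \<partial>lborel_on 0 (pi / 2)) = ennreal (3 * ln 2 * (pi / 2) ^ 3)"
proof -
  let ?H = "lborel_on 0 (pi / 2)"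
  let ?p = "ennreal (pi / 2)" and ?c = "ennreal (pi / 2 * ln 2)"
  have c: "(\<integral>\<^sup>+x. ennreal (- ln (cos x)) \<partial>?H) = ?c"
    using nn_integral_ln_sin by (simp add: nn_integral_ln_cos_eq_sin)
  have "octant_integral + (\<integral>\<^sup>+a. cos_ratio_integral (cos a / sin a) \<partial>?H) =
     (\<integral>\<^sup>+a. \<integral>\<^sup>+b. \<integral>\<^sup>+d. ennreal (ln 8 - ln (max (4 * \<bar>cos a * cos b\<bar>) (4 * \<bar>sin a * cos d\<bar>))) +
        ennreal (max 0 (ln (cos a / sin a * cos b / cos d))) \<partial>?H \<partial>?H \<partial>?H)"
    unfolding octant_integral_def octant_integrand_def cos_ratio_integral_def by (simp add: nn_integral_add)
  also have "\<dots> = (\<integral>\<^sup>+a. \<integral>\<^sup>+b. \<integral>\<^sup>+d. ennreal (ln 2) + ennreal (- ln (sin a)) + ennreal (- ln (cos d)) \<partial>?H \<partial>?H \<partial>?H)"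
  proof (intro nn_integral_lborel_on_cong)
    fix a b d :: real
    assume *: "0 < a" "a < pi / 2" "0 < b" "b < pi / 2" "0 < d" "d < pi / 2"
    define u v where "u = cos a * cos b" and "v = sin a * cos d"
    have pos: "0 < sin a" "0 < cos a" "0 < cos b" "0 < cos d"
      using * by (auto intro!: sin_gt_zero cos_gt_zero)
    then have uv: "0 < u" "0 < v" by (auto simp: u_def v_def)
    have "u \<le> 1 * 1" "v \<le> 1 * 1"
      unfolding u_def v_def using pos by (intro mult_mono; simp)+
    then have "ln (max (4 * u) (4 * v)) \<le> ln 8"
      using uv by (intro ln_mono) auto
    moreover have "ln (cos a / sin a * cos b / cos d) = ln (4 * u) - ln (4 * v)"
      using pos by (simp add: u_def v_def ln_mult ln_div)
    moreover have "ln (4 * v) = ln 4 + ln (sin a) + ln (cos d)"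
      using pos by (simp add: v_def ln_mult)
    moreover have "ln (8::real) = ln 4 + ln 2"
      using ln_mult[of 4 "2::real"] by simp
    moreover have "ln (max (4 * u) (4 * v)) = max (ln (4 * u)) (ln (4 * v))"
      using uv by (auto simp: max_def)
    ultimately have "ln 8 - ln (max (4 * u) (4 * v)) + max 0 (ln (cos a / sin a * cos b / cos d)) =
       ln 2 + - ln (sin a) + - ln (cos d)" "0 \<le> ln 8 - ln (max (4 * u) (4 * v))"
      by (auto simp: max_def)
    moreover have "0 \<le> - ln (sin a)" "0 \<le> - ln (cos d)" "0 \<le> ln (2::real)"
      using pos by auto
    ultimately have "ennreal (ln 8 - ln (max (4 * u) (4 * v))) + ennreal (max 0 (ln (cos a / sin a * cos b / cos d))) =
       ennreal (ln 2) + ennreal (- ln (sin a)) + ennreal (- ln (cos d))"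
      by (simp only: add_nonneg_nonneg max.cobounded1 flip: ennreal_plus)
    then show "ennreal (ln 8 - ln (max (4 * \<bar>cos a * cos b\<bar>) (4 * \<bar>sin a * cos d\<bar>))) +
        ennreal (max 0 (ln (cos a / sin a * cos b / cos d))) =
       ennreal (ln 2) + ennreal (- ln (sin a)) + ennreal (- ln (cos d))"
      using uv by (simp flip: u_def v_def)
  qed
  also have "\<dots> = ennreal (ln 2) * ?p * ?p * ?p + ?c * ?p * ?p + ?c * ?p * ?p"
    by (simp add: nn_integral_add nn_integral_multc nn_integral_ln_sin c distrib_right)
  also have "\<dots> = ennreal (3 * ln 2 * (pi / 2) ^ 3)"
    by (simp add: power3_eq_cube flip: ennreal_mult ennreal_plus)
  finally show ?thesis .
qed

theorem mainTheorem10: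
  shows "let w = pvar 0; x = pvar 1; y = pvar 2; z = pvar 3 in
    \<exists>S :: real.
      (\<lambda>N :: nat. \<Sum>(j, k)\<in>{(j, k). 0 \<le> j \<and> j < k \<and> k \<le> N}.
          (-1) ^ (j + k + 1) / ((2 * real j + 1) ^ 3 * real k)) \<longlonglongrightarrow> S \<and>
      pi ^ 3 * mahler_measure 4 ((1 + w) * (1 + x) + (1 - w) * (y + z)) =
        2 * pi\<^sup>2 * L_series chi_m4 2 + 8 * S"
proof -
  define P where "P = (1 + pvar 0) * (1 + pvar 1) + (1 - pvar 0) * (pvar 2 + pvar 3)"
  define S where "S = suminf (\<lambda>j. 2 * tan_power_integral j / (2 * real j + 1) ^ 3)"
  define q where "q = (pi / 2)\<^sup>2 * L_series chi_m4 2 + S"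
  let ?M = "\<Pi>\<^sub>M k\<in>{..<4::nat}. (lborel :: real measure)"
  let ?B = "\<Pi>\<^sub>E k\<in>{..<4::nat}. {0..2 * pi}"
  let ?F = "\<lambda>t. ln (cmod (torus_value (t 0) (t 1) (t 2) (t 3)))"
  interpret product_sigma_finite "\<lambda>k::nat. lborel :: real measure" ..
  have P: "peval P (\<lambda>k. cis (t k)) = torus_value (t 0) (t 1) (t 2) (t 3)" for t
    by (simp add: P_def torus_value_def peval_add peval_mult peval_diff)
  have lim: "(\<lambda>N :: nat. \<Sum>(j, k)\<in>{(j, k). 0 \<le> j \<and> j < k \<and> k \<le> N}.
          (-1) ^ (j + k + 1) / ((2 * real j + 1) ^ 3 * real k)) \<longlonglongrightarrow> S"
    unfolding S_def using tan_power_integral_nonneg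
    by (intro double_sum_limit two_tan_power_integral_rec) simp
  have "0 \<le> S"
    unfolding S_def using tan_power_integral_nonneg
    by (intro suminf_nonneg double_sum_limit two_tan_power_integral_rec) auto
  then have "0 \<le> q"
    unfolding q_def using nn_integral_ln_tan(2) by simp
  have oct: "octant_integral + ennreal q = ennreal (3 * ln 2 * (pi / 2) ^ 3)"
    using octant_integral_plus_cos_ratio_integral
    unfolding nn_integral_cos_ratio_integral_cot q_def S_def .
  then have "octant_integral < top"
    by (metis ennreal_add_eq_top ennreal_neq_top less_top)
  then obtain r where r: "0 \<le> r" "octant_integral = ennreal r"
    by (cases octant_integral) auto
  have rq: "r + q = 3 * ln 2 * (pi / 2) ^ 3"
  proof -
    have "ennreal (r + q) = ennreal (3 * ln 2 * (pi / 2) ^ 3)"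
      using oct r(1) \<open>0 \<le> q\<close> unfolding r(2) by (simp only: ennreal_plus)
    moreover have "0 \<le> r + q" "0 \<le> 3 * ln 2 * (pi / 2) ^ 3"
      using r(1) \<open>0 \<le> q\<close> by auto
    ultimately show ?thesis
      by (simp only: ennreal_inj)
  qed
  have [measurable]: "?B \<in> sets ?M"
    by (intro sets_PiM_I_finite) auto
  have [measurable]: "(\<lambda>t. torus_value (t 0) (t 1) (t 2) (t 3)) \<in> borel_measurable ?M"
    by measurable
  \<comment> \<open>Subtracting from the bound \<open>ln 8\<close> makes the integrand nonnegative, so its nonnegative integral also gives integrability.\<close>
  have I1: "has_bochner_integral ?M (\<lambda>t. indicator ?B t * (ln 8 - ?F t)) (128 * pi * r)"
  proof (rule has_bochner_integral_nn_integral)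
    have "(\<integral>\<^sup>+t. ennreal (indicator ?B t * (ln 8 - ?F t)) \<partial>?M) =
        (\<integral>\<^sup>+t. indicator ?B t * ennreal (ln 8 - ?F t) \<partial>?M)"
      by (intro nn_integral_cong) (simp add: indicator_def)
    also have "\<dots> = ennreal (128 * pi) * octant_integral"
      using nn_integral_torus[of "\<lambda>z. ennreal (ln 8 - ln (cmod z))"] nn_integral_torus_value by simp
    also have "\<dots> = ennreal (128 * pi * r)"
      using r by (simp add: ennreal_mult)
    finally show "(\<integral>\<^sup>+t. ennreal (indicator ?B t * (ln 8 - ?F t)) \<partial>?M) = ennreal (128 * pi * r)" .
    show "AE t in ?M. 0 \<le> indicator ?B t * (ln 8 - ?F t)"
      using ln_norm_torus_value_le by (intro AE_I2 mult_nonneg_nonneg) auto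
  qed (use r in auto)
  have I2: "has_bochner_integral ?M (\<lambda>t. indicator ?B t * ln 8) ((2 * pi) ^ 4 * ln 8)"
  proof -
    have "emeasure ?M ?B = ennreal ((2 * pi) ^ 4)"
      by (subst emeasure_PiM) (auto simp: ennreal_power power_mult_distrib)
    then have "has_bochner_integral ?M (indicator ?B) ((2 * pi) ^ 4)"
      using has_bochner_integral_real_indicator[of ?B ?M] by (simp add: measure_def)
    then show ?thesis
      by (rule has_bochner_integral_mult_left)
  qed
  have "has_bochner_integral ?M (\<lambda>t. indicator ?B t * ?F t) ((2 * pi) ^ 4 * ln 8 - 128 * pi * r)"
    using has_bochner_integral_diff[OF I2 I1] by (simp add: algebra_simps)
  then have mahler: "mahler_measure 4 P = 1 / (2 * pi) ^ 4 * ((2 * pi) ^ 4 * ln 8 - 128 * pi * r)"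
    unfolding mahler_measure_def P set_lebesgue_integral_def
    by (simp add: has_bochner_integral_integral_eq)
  have "pi ^ 3 * mahler_measure 4 P = pi ^ 3 * ln 8 - 8 * r"
    unfolding mahler by (simp add: field_simps power_numeral_reduce)
  also have "ln (8::real) = 3 * ln 2"
    using ln_realpow[of 2 3] by simp
  also have "pi ^ 3 * (3 * ln 2) - 8 * r = 8 * q"
    using rq by (simp add: field_simps)
  also have "\<dots> = 2 * pi\<^sup>2 * L_series chi_m4 2 + 8 * S"
    by (simp add: q_def power_divide)
  finally show ?thesis
    using lim by (auto simp: Let_def P_def)
qed

end
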